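(* Fix an integer $r\ge 2$. If $H$ is an $r$-star-flip graph, then $\mathrm{ex}(n,H)=O_H(n^{2-1/r})$; that is, there is a constant $C>0$ depending only on $H$ (and the fixed $r$) such that $\mathrm{ex}(n,H)\le C\,n^{2-1/r}$ for all positive integers $n$.
   Context: All graphs are finite and simple. For a graph $F$ and a positive integer $n$, the Turán number $\mathrm{ex}(n,F)$ is the maximum number of edges in an $n$-vertex graph containing no subgraph isomorphic to $F$ (with the maximum of the empty set taken to be $0$). Notation: $N_T(c)$ and $d_T(c)$ denote the neighbourhood and the degree of a vertex $c$ in $T$, and $[m]=\{1,\dots,m\}$. A subtree of a tree is a (nonempty) connected subgraph. Definition ($r$-star-flip graph). Fix an integer $r\ge 2$. An $r$-star-flip presentation of a graph $H$ consists of a sequence of graphs $H_0\subset H_1\subset\cdots\subset H_m=H$ (with $m\ge 0$) together with families $\mathcal T_0,\mathcal T_1,\dots,\mathcal T_m$ of trees, whose members are called live trees, constructed recursively as follows. - The initial graph $H_0=R$ is a tree, called the seed tree, and $\mathcal T_0$ is the family of all subtrees of $R$. - Suppose $H_{i-1}$ and $\mathcal T_{i-1}$ have been defined, for some $i\in[m]$. Choose a live tree $T_i\in\mathcal T_{i-1}$ and a vertex $c_i\in V(T_i)$ such that $1\le k_i:=d_{T_i}(c_i)\le r$. Introduce a new vertex $x_i\notin V(H_{i-1})$ and join it precisely to the vertices of $N_{T_i}(c_i)$, i.e. $V(H_i)=V(H_{i-1})\cup\{x_i\}$ and $E(H_i)=E(H_{i-1})\cup\{x_ia: a\in N_{T_i}(c_i)\}$.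 - Let $\mathcal S_i=\{T\in\mathcal T_{i-1}: c_i\in V(T)\text{ and }N_T(c_i)=N_{T_i}(c_i)\}$. For $T\in\mathcal S_i$, let $T^{x_i}$ be the tree obtained from $T$ by replacing $c_i$ with $x_i$. Then $\mathcal T_i=\mathcal T_{i-1}\cup\bigcup_{T\in\mathcal S_i}\{Q: Q\text{ is a subtree of }T^{x_i}\}$. The passage from $(H_{i-1},\mathcal T_{i-1})$ to $(H_i,\mathcal T_i)$ is called a star flip of size $k_i$, performed at $c_i$ with neighbour set $N_{T_i}(c_i)$. A graph $H$ is called an $r$-star-flip graph if it admits an $r$-star-flip presentation. *)

theory Defs
  imports Complex_Main
begin

section \<open>Finite simple graphs\<close>

type_synonym 'a sgraph = "'a set \<times> 'a set set"

abbreviation verts :: "'a sgraph \<Rightarrow> 'a set" where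
  "verts G \<equiv> fst G"

abbreviation edges :: "'a sgraph \<Rightarrow> 'a set set" where
  "edges G \<equiv> snd G"

definition simple_graph :: "'a sgraph \<Rightarrow> bool" where
  "simple_graph G \<longleftrightarrow> finite (verts G) \<and> (\<forall>e\<in>edges G. e \<subseteq> verts G \<and> card e = 2)"

definition adjacent :: "'a sgraph \<Rightarrow> 'a \<Rightarrow> 'a \<Rightarrow> bool" where
  "adjacent G u v \<longleftrightarrow> {u, v} \<in> edges G"

definition neighbourhood :: "'a sgraph \<Rightarrow> 'a \<Rightarrow> 'a set" where
  "neighbourhood G v = {a. adjacent G v a}"

definition degree :: "'a sgraph \<Rightarrow> 'a \<Rightarrow> nat" where
  "degree G v = card (neighbourhood G v)"

definition subgraph :: "'a sgraph \<Rightarrow> 'a sgraph \<Rightarrow> bool" where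
  "subgraph S G \<longleftrightarrow> simple_graph S \<and> verts S \<subseteq> verts G \<and> edges S \<subseteq> edges G"

definition isomorphic :: "'a sgraph \<Rightarrow> 'b sgraph \<Rightarrow> bool" where
  "isomorphic F G \<longleftrightarrow>
     (\<exists>f. bij_betw f (verts F) (verts G) \<and>
          (\<forall>u\<in>verts F. \<forall>v\<in>verts F. adjacent F u v \<longleftrightarrow> adjacent G (f u) (f v)))"

definition contains_copy :: "'b sgraph \<Rightarrow> 'a sgraph \<Rightarrow> bool" where
  "contains_copy G F \<longleftrightarrow> (\<exists>S. subgraph S G \<and> isomorphic F S)"

definition connected_graph :: "'a sgraph \<Rightarrow> bool" where
  "connected_graph G \<longleftrightarrow>
     verts G \<noteq> {} \<and> (\<forall>u\<in>verts G. \<forall>v\<in>verts G. (adjacent G)\<^sup>*\<^sup>* u v)"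

text \<open>A cycle is given by its cyclic sequence of at least three distinct vertices.\<close>

definition is_cycle :: "'a sgraph \<Rightarrow> 'a list \<Rightarrow> bool" where
  "is_cycle G p \<longleftrightarrow> length p \<ge> 3 \<and> distinct p \<and>
     (\<forall>i<length p. adjacent G (p ! i) (p ! (Suc i mod length p)))"

definition tree :: "'a sgraph \<Rightarrow> bool" where
  "tree G \<longleftrightarrow> simple_graph G \<and> connected_graph G \<and> (\<nexists>p. is_cycle G p)"

definition subtree :: "'a sgraph \<Rightarrow> 'a sgraph \<Rightarrow> bool" where
  "subtree Q T \<longleftrightarrow> subgraph Q T \<and> connected_graph Q"


section \<open>Turan numbers\<close>

text \<open>Every finite graph has an isomorphic copy with natural numbers as vertices, so host graphs
  on the type \<^typ>\<open>nat\<close> suffice.  Inserting \<open>0\<close> makes the maximum of the empty set \<open>0\<close>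
  and does not change the maximum of a nonempty set.\<close>

definition turan_number :: "nat \<Rightarrow> 'a sgraph \<Rightarrow> nat" where
  "turan_number n F =
     Max (insert 0 {card (edges G) |G :: nat sgraph.
            simple_graph G \<and> card (verts G) = n \<and> \<not> contains_copy G F})"

text \<open>The set under \<^const>\<open>Max\<close> is finite.\<close>

lemma card_edges_le:
  assumes "simple_graph G"
  shows "card (edges G) \<le> 2 ^ card (verts G)"
proof -
  have "edges G \<subseteq> Pow (verts G)" and fin: "finite (verts G)"
    using assms by (auto simp: simple_graph_def)
  then have "card (edges G) \<le> card (Pow (verts G))"
    by (intro card_mono) auto
  then show ?thesis using fin by (simp add: card_Pow)
qed

lemma finite_turan_candidates:
  "finite {card (edges G) |G :: nat sgraph.
      simple_graph G \<and> card (verts G) = n \<and> \<not> contains_copy G F}"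
  by (rule finite_subset[of _ "{..2 ^ n}"]) (use card_edges_le in auto)


section \<open>Star-flip graphs\<close>

definition add_vertex :: "'a \<Rightarrow> 'a set \<Rightarrow> 'a sgraph \<Rightarrow> 'a sgraph" where
  "add_vertex x A G = (insert x (verts G), edges G \<union> {{x, a} |a. a \<in> A})"

text \<open>Relabels \<open>c\<close> as \<open>x\<close>; it is only used when \<open>x\<close> is not a vertex of \<open>T\<close>.\<close>

definition replace_vertex :: "'a \<Rightarrow> 'a \<Rightarrow> 'a sgraph \<Rightarrow> 'a sgraph" where
  "replace_vertex c x T = (id(c := x) ` verts T, (\<lambda>e. id(c := x) ` e) ` edges T)"

text \<open>\<open>star_flip_presentation r H \<T>\<close>: some finite sequence of star flips of sizes between
  \<open>1\<close> and \<open>r\<close>, starting from a seed tree, ends with the graph \<open>H\<close> and the family \<open>\<T>\<close> of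
  live trees.  All intermediate graphs are subgraphs of \<open>H\<close>, so they live on the same vertex
  type as \<open>H\<close>.\<close>

inductive star_flip_presentation :: "nat \<Rightarrow> 'a sgraph \<Rightarrow> 'a sgraph set \<Rightarrow> bool"
  for r :: nat where
  seed: "tree R \<Longrightarrow> star_flip_presentation r R {Q. subtree Q R}"
| flip: "\<lbrakk>star_flip_presentation r H \<T>;
          T \<in> \<T>; c \<in> verts T; 1 \<le> degree T c; degree T c \<le> r;
          x \<notin> verts H;
          \<S> = {T' \<in> \<T>. c \<in> verts T' \<and> neighbourhood T' c = neighbourhood T c}\<rbrakk>
    \<Longrightarrow> star_flip_presentation r
          (add_vertex x (neighbourhood T c) H)
          (\<T> \<union> (\<Union>T'\<in>\<S>. {Q. subtree Q (replace_vertex c x T')}))"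

definition star_flip_graph :: "nat \<Rightarrow> 'a sgraph \<Rightarrow> bool" where
  "star_flip_graph r H \<longleftrightarrow> (\<exists>\<T>. star_flip_presentation r H \<T>)"

end

theory Submission
  imports Defs "HOL-Library.FuncSet"
begin

text \<open>
  Pass to a subgraph \<open>G\<close> of minimum degree \<open>\<delta> \<ge> C n\<^sup>1\<^sup>-\<^sup>1\<^sup>/\<^sup>r\<close>.  Map the seed tree to \<open>G\<close> by the
  tree-indexed stationary random walk, and at each star flip let the new vertex be a copy of the
  centre, resampled independently given the images of the neighbours.  By the Markov property every
  live tree is then again distributed as a random walk; this is exactly what makes the next flip
  possible.  In a flip of size \<open>k\<close> the new vertex meets a given old vertex with probability at most
  the expected maximum of the resampling law.  Since a \<open>k\<close>-star has probability at most
  \<open>\<delta>\<^sup>1\<^sup>-\<^sup>k / (n \<delta>)\<close> and there are \<open>n\<^sup>k\<close> tuples of leaves, this is at most \<open>n\<^sup>k\<^sup>-\<^sup>1 / \<delta>\<^sup>k \<le> 1 / C\<close>,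
  because \<open>k \<le> r\<close>.  For large \<open>C\<close> a union bound yields an injective homomorphism from \<open>H\<close>.
\<close>

section \<open>Trees and their subtrees\<close>

lemma adjacent_sym: "adjacent G u v \<longleftrightarrow> adjacent G v u"
  by (simp add: adjacent_def insert_commute)

lemma adjacentD:
  assumes "simple_graph G" "adjacent G u v"
  shows "u \<in> verts G" "v \<in> verts G" "u \<noteq> v"
  using assms by (auto simp: simple_graph_def adjacent_def dest!: bspec)

lemma finite_edges: "simple_graph G \<Longrightarrow> finite (edges G)"
  by (rule finite_subset[of _ "Pow (verts G)"]) (auto simp: simple_graph_def)

lemma edge_obtain:
  assumes "simple_graph G" "e \<in> edges G"
  obtains u v where "e = {u, v}" "u \<noteq> v" "adjacent G u v"
  using assms by (auto simp: simple_graph_def adjacent_def card_2_iff)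

lemma neighbourhood_subset: "simple_graph G \<Longrightarrow> neighbourhood G v \<subseteq> verts G - {v}"
  using adjacentD(2,3)[of G v] by (auto simp: neighbourhood_def)

lemma finite_neighbourhood: "simple_graph G \<Longrightarrow> finite (neighbourhood G v)"
  by (meson finite_Diff finite_subset neighbourhood_subset simple_graph_def)

lemma edges_at:
  assumes "simple_graph G"
  shows "{e \<in> edges G. v \<in> e} = (\<lambda>a. {v, a}) ` neighbourhood G v"
proof -
  have "e \<in> (\<lambda>a. {v, a}) ` neighbourhood G v" if e: "e \<in> edges G" "v \<in> e" for e
  proof -
    obtain a b where ab: "e = {a, b}" "adjacent G a b"
      using edge_obtain[OF assms e(1)] by metis
    then show ?thesis
      using e(2) adjacent_sym[of G a b] by (auto simp: neighbourhood_def insert_commute)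
  qed
  then show ?thesis by (auto simp: neighbourhood_def adjacent_def)
qed

lemma inj_on_doubleton: "inj_on (\<lambda>a. {v, a}) A"
  by (auto simp: inj_on_def doubleton_eq_iff)

lemma simple_add_vertex:
  assumes "simple_graph G" "x \<notin> verts G" "A \<subseteq> verts G"
  shows "simple_graph (add_vertex x A G)"
proof -
  have "card {x, a} = 2" if "a \<in> A" for a
    using that assms by (metis card_2_iff subsetD)
  then show ?thesis using assms by (auto simp: simple_graph_def add_vertex_def)
qed

lemma subgraph_trans: "subgraph A B \<Longrightarrow> subgraph B C \<Longrightarrow> subgraph A C"
  by (auto simp: subgraph_def)

lemma subgraph_adjacent: "subgraph A B \<Longrightarrow> adjacent A u v \<Longrightarrow> adjacent B u v"
  by (auto simp: subgraph_def adjacent_def)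

lemma subtree_trans: "subtree A B \<Longrightarrow> subtree B C \<Longrightarrow> subtree A C"
  by (auto simp: subtree_def intro: subgraph_trans)

lemma is_cycle_subgraph: "subgraph A B \<Longrightarrow> is_cycle A p \<Longrightarrow> is_cycle B p"
  by (auto simp: is_cycle_def intro: subgraph_adjacent)

lemma tree_subtree: "tree T \<Longrightarrow> subtree Q T \<Longrightarrow> tree Q"
  unfolding tree_def subtree_def using is_cycle_subgraph[of Q T] by (auto simp: subgraph_def)

text \<open>Loop erasure: when the walk returns to a vertex of the path built so far, the path is
  cut back to that vertex.\<close>

lemma rtranclp_distinct_path:
  assumes "R\<^sup>*\<^sup>* u v"
  shows "\<exists>p. p \<noteq> [] \<and> hd p = u \<and> last p = v \<and> distinct p \<and> successively R p"
  using assms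
proof (induction rule: rtranclp_induct)
  case base
  show ?case by (rule exI[of _ "[u]"]) simp
next
  case (step y z)
  then obtain p where p: "p \<noteq> []" "hd p = u" "last p = y" "distinct p" "successively R p"
    by blast
  show ?case
  proof (cases "z \<in> set p")
    case True
    then obtain a b where ab: "p = a @ z # b" by (meson split_list)
    have "successively R (a @ [z])"
      using p(5) ab by (auto simp: successively_append_iff)
    then show ?thesis
      using p ab by (intro exI[of _ "a @ [z]"]) (auto simp: hd_append)
  next
    case False
    then show ?thesis
      using p step.hyps by (intro exI[of _ "p @ [z]"]) (auto simp: successively_append_iff)
  qed
qed

lemma is_cycleI:
  assumes "length p \<ge> 3" "distinct p" "successively (adjacent G) p" "adjacent G (last p) (hd p)"
  shows "is_cycle G p"
  unfolding is_cycle_def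
proof (intro conjI allI impI assms(1,2))
  fix i assume i: "i < length p"
  show "adjacent G (p ! i) (p ! (Suc i mod length p))"
  proof (cases "Suc i = length p")
    case True
    then have "p \<noteq> []" "i = length p - 1" by auto
    then show ?thesis using assms(4) True by (simp add: last_conv_nth hd_conv_nth)
  next
    case False
    then have "Suc i < length p" using i by simp
    then show ?thesis using assms(3) by (simp add: successively_conv_nth)
  qed
qed

text \<open>Otherwise a path inside \<open>Q\<close> from \<open>u\<close> to \<open>v\<close> has
  at least three vertices, and the edge of \<open>T\<close> between its ends closes it to a
  cycle.\<close>

lemma subtree_induced:
  assumes T: "tree T" and Q: "subtree Q T" and uv: "u \<in> verts Q" "v \<in> verts Q" "adjacent T u v"
  shows "adjacent Q u v"
proof (rule ccontr)
  assume nadj: "\<not> adjacent Q u v"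
  have "(adjacent Q)\<^sup>*\<^sup>* u v" using Q uv by (simp add: subtree_def connected_graph_def)
  then obtain p where p: "p \<noteq> []" "hd p = u" "last p = v" "distinct p" "successively (adjacent Q) p"
    using rtranclp_distinct_path by metis
  have "u \<noteq> v" using T uv adjacentD(3)[of T u v] by (auto simp: tree_def)
  then obtain w q where q: "p = u # w # q"
    using p by (cases p; cases "tl p") auto
  have "q \<noteq> []" using q p nadj by auto
  then have "length p \<ge> 3" using q by (cases q) auto
  moreover have "successively (adjacent T) p"
    using p(5) by (rule successively_mono) (use Q in \<open>auto simp: subtree_def intro: subgraph_adjacent\<close>)
  ultimately have "is_cycle T p"
    using p uv(3) by (intro is_cycleI) (auto simp: adjacent_sym)
  then show False using T by (auto simp: tree_def)
qed

lemma subtree_spanning: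
  assumes "tree T" "subtree Q T" "verts Q = verts T"
  shows "Q = T"
proof -
  have "e \<in> edges Q" if e: "e \<in> edges T" for e
  proof -
    obtain u v where uv: "e = {u, v}" "adjacent T u v"
      using edge_obtain[of T e] e assms(1) by (metis tree_def)
    then have "u \<in> verts Q" "v \<in> verts Q"
      using adjacentD[of T] assms by (auto simp: tree_def)
    then show ?thesis using subtree_induced[OF assms(1,2)] uv by (auto simp: adjacent_def)
  qed
  then have "edges Q = edges T" using assms(2) by (auto simp: subtree_def subgraph_def)
  then show ?thesis using assms(3) by (simp add: prod_eq_iff)
qed

section \<open>Growing a subtree leaf by leaf\<close>

lemma rtranclp_leaves:
  assumes "R\<^sup>*\<^sup>* u v" "u \<in> S" "v \<notin> S"
  shows "\<exists>p l. p \<in> S \<and> l \<notin> S \<and> R p l"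
  using assms by (induction rule: rtranclp_induct) auto

lemma connected_add_leaf:
  assumes "connected_graph Q" "p \<in> verts Q"
  shows "connected_graph (add_vertex l {p} Q)"
proof -
  let ?Q = "add_vertex l {p} Q"
  have lift: "(adjacent ?Q)\<^sup>*\<^sup>* u v" if "u \<in> verts Q" "v \<in> verts Q" for u v
    by (rule rtranclp_mono[THEN predicate2D, of "adjacent Q"])
      (use assms that in \<open>auto simp: connected_graph_def adjacent_def add_vertex_def\<close>)
  have "adjacent ?Q l p" "adjacent ?Q p l"
    by (auto simp: adjacent_def add_vertex_def)
  then have "(adjacent ?Q)\<^sup>*\<^sup>* u p \<and> (adjacent ?Q)\<^sup>*\<^sup>* p u" if "u \<in> verts ?Q" for u
    using that lift assms(2) by (auto simp: add_vertex_def)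
  then have "(adjacent ?Q)\<^sup>*\<^sup>* u v" if "u \<in> verts ?Q" "v \<in> verts ?Q" for u v
    using that by (meson rtranclp_trans)
  moreover have "verts ?Q \<noteq> {}" by (simp add: add_vertex_def)
  ultimately show ?thesis by (simp only: connected_graph_def) blast
qed

text \<open>A walk in \<open>T\<close> from \<open>Q\<close> to a vertex outside \<open>Q\<close>
  must leave \<open>Q\<close> along some edge, and this edge attaches the new leaf.\<close>

lemma subtree_extend:
  assumes T: "tree T" and Q: "subtree Q T" and neq: "verts Q \<noteq> verts T"
  obtains p l where "p \<in> verts Q" "l \<notin> verts Q" "subtree (add_vertex l {p} Q) T"
proof -
  have sub: "verts Q \<subseteq> verts T" using Q by (auto simp: subtree_def subgraph_def)
  obtain u v where "u \<in> verts Q" "v \<in> verts T" "v \<notin> verts Q"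
    using Q neq sub by (auto simp: subtree_def connected_graph_def)
  then have "(adjacent T)\<^sup>*\<^sup>* u v" using T sub by (auto simp: tree_def connected_graph_def)
  then obtain p l where pl: "p \<in> verts Q" "l \<notin> verts Q" "adjacent T p l"
    using rtranclp_leaves[OF _ \<open>u \<in> verts Q\<close> \<open>v \<notin> verts Q\<close>] by blast
  have "subgraph (add_vertex l {p} Q) T"
    using Q T pl adjacentD[of T p l] simple_add_vertex[of Q l "{p}"]
    by (auto simp: subtree_def subgraph_def tree_def) (auto simp: add_vertex_def adjacent_def insert_commute)
  then have "subtree (add_vertex l {p} Q) T"
    using Q connected_add_leaf[OF _ pl(1)] by (simp add: subtree_def)
  then show ?thesis using that pl by blast
qed

text \<open>Starting the induction at an arbitrary subtree \<open>Q\<close> serves two purposes: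
  comparing the walk on \<open>T\<close> with the walk on \<open>Q\<close>, and building
  \<open>T\<close> from a single vertex.\<close>

lemma subtree_induct [consumes 2, case_names base leaf]:
  assumes T: "tree T" and "subtree Q T" and "P Q"
    and step: "\<And>S l p. \<lbrakk>subtree S T; P S; l \<notin> verts S; p \<in> verts S\<rbrakk> \<Longrightarrow> P (add_vertex l {p} S)"
  shows "P T"
  using assms(2,3)
proof (induction "card (verts T - verts Q)" arbitrary: Q rule: less_induct)
  case less
  show ?case
  proof (cases "verts Q = verts T")
    case True
    then show ?thesis using subtree_spanning[OF T less.prems(1)] less.prems(2) by simp
  next
    case False
    then obtain p l where pl: "p \<in> verts Q" "l \<notin> verts Q" "subtree (add_vertex l {p} Q) T"
      using subtree_extend[OF T less.prems(1)] by blast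
    have "l \<in> verts T" using pl(3) by (auto simp: subtree_def subgraph_def add_vertex_def)
    then have "card (verts T - verts (add_vertex l {p} Q)) < card (verts T - verts Q)"
      using T pl by (intro psubset_card_mono) (auto simp: tree_def simple_graph_def add_vertex_def)
    then show ?thesis using less.hyps pl step less.prems by blast
  qed
qed

section \<open>Relabelling a vertex of a tree\<close>

lemma adjacent_replace_vertex:
  assumes "simple_graph T" "x \<notin> verts T" "adjacent (replace_vertex c x T) u v"
  shows "adjacent T ((id(x := c)) u) ((id(x := c)) v)"
proof -
  obtain e where e: "e \<in> edges T" "id(c := x) ` e = {u, v}"
    using assms(3) by (auto simp: adjacent_def replace_vertex_def)
  have "x \<notin> e" using e(1) assms by (auto simp: simple_graph_def)
  then have "id(x := c) ` (id(c := x) ` e) = e" by (force simp: image_image)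
  then have "{(id(x := c)) u, (id(x := c)) v} = e" using e(2) by auto
  then show ?thesis using e(1) by (simp add: adjacent_def)
qed

lemma inj_on_replace: "x \<notin> V \<Longrightarrow> inj_on (id(c := x)) V"
  by (auto simp: inj_on_def)

text \<open>Cycles of the relabelled graph are pulled back along \<open>id(x := c)\<close>. This map
  is injective on them because \<open>c\<close> is no longer a vertex.\<close>

lemma tree_replace_vertex:
  assumes T: "tree T" and x: "x \<notin> verts T" and c: "c \<in> verts T"
  shows "tree (replace_vertex c x T)"
proof -
  let ?T = "replace_vertex c x T"
  have simple: "simple_graph T" and conn: "connected_graph T" using T by (auto simp: tree_def)
  have "simple_graph ?T"
    unfolding simple_graph_def
  proof (intro conjI ballI)
    show "finite (verts ?T)" using simple by (simp add: simple_graph_def replace_vertex_def)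
    fix e assume "e \<in> edges ?T"
    then obtain e' where e': "e' \<in> edges T" "e = id(c := x) ` e'" by (auto simp: replace_vertex_def)
    then have "e' \<subseteq> verts T" "card e' = 2" using simple by (auto simp: simple_graph_def)
    then show "e \<subseteq> verts ?T" "card e = 2"
      using e' x card_image[OF inj_on_replace, of x e' c] by (auto simp: replace_vertex_def)
  qed
  moreover have "connected_graph ?T"
  proof -
    have hom: "adjacent ?T ((id(c := x)) u) ((id(c := x)) v)" if "adjacent T u v" for u v
      using imageI[of "{u, v}" "edges T" "\<lambda>e. id(c := x) ` e"] that
      by (simp only: adjacent_def replace_vertex_def snd_conv image_insert image_empty)
    have "(adjacent ?T)\<^sup>*\<^sup>* ((id(c := x)) u) ((id(c := x)) v)" if "(adjacent T)\<^sup>*\<^sup>* u v" for u v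
      using that
    proof (induction rule: rtranclp_induct)
      case (step y z)
      show ?case by (rule rtranclp.rtrancl_into_rtrancl[OF step.IH hom[OF step.hyps(2)]])
    qed simp
    then show ?thesis using conn
      unfolding connected_graph_def replace_vertex_def fst_conv by blast
  qed
  moreover have "\<not> is_cycle ?T p" for p
  proof
    assume p: "is_cycle ?T p"
    let ?\<tau> = "id(x := c)"
    have "p ! i \<noteq> c" if i: "i < length p" for i
    proof -
      have "adjacent ?T (p ! i) (p ! (Suc i mod length p))" using p i by (auto simp: is_cycle_def)
      then have "p ! i \<in> verts ?T" using \<open>simple_graph ?T\<close> adjacentD by metis
      then show ?thesis using x c by (auto simp: replace_vertex_def)
    qed
    then have "c \<notin> set p" by (auto simp: in_set_conv_nth)
    then have "distinct (map ?\<tau> p)"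
      using p inj_on_replace[of c "set p" x] by (simp add: distinct_map is_cycle_def)
    moreover have "adjacent T (map ?\<tau> p ! i) (map ?\<tau> p ! (Suc i mod length p))" if i: "i < length p" for i
    proof -
      have "adjacent ?T (p ! i) (p ! (Suc i mod length p))" using p i by (auto simp: is_cycle_def)
      from adjacent_replace_vertex[OF simple x this] show ?thesis
        using i by (simp only: nth_map length_map mod_less_divisor order.strict_trans1[OF le0])
    qed
    ultimately have "is_cycle T (map ?\<tau> p)" using p by (simp add: is_cycle_def)
    then show False using T by (auto simp: tree_def)
  qed
  ultimately show ?thesis by (auto simp: tree_def)
qed

section \<open>Single vertices and stars as subtrees\<close>

lemma subtree_vertex: "simple_graph T \<Longrightarrow> v \<in> verts T \<Longrightarrow> subtree ({v}, {}) T"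
  by (auto simp: subtree_def subgraph_def simple_graph_def connected_graph_def)

definition star :: "'a \<Rightarrow> 'a set \<Rightarrow> 'a sgraph" where
  "star c N = add_vertex c N (N, {})"

text \<open>By closure under subtrees, the star used in a flip is itself a live tree, so its law is
  known when collisions are estimated.\<close>

lemma subtree_star:
  assumes T: "simple_graph T" and c: "c \<in> verts T"
  shows "subtree (star c (neighbourhood T c)) T"
proof -
  let ?S = "star c (neighbourhood T c)"
  have "simple_graph ?S"
    unfolding star_def using neighbourhood_subset[OF T, of c] finite_neighbourhood[OF T]
    by (intro simple_add_vertex) (auto simp: simple_graph_def)
  then have "subgraph ?S T"
    using neighbourhood_subset[OF T, of c] c
    by (auto simp: subgraph_def star_def add_vertex_def neighbourhood_def adjacent_def)
  have "adjacent ?S c u \<and> adjacent ?S u c" if "u \<in> neighbourhood T c" for u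
    using that by (auto simp: star_def add_vertex_def adjacent_def)
  then have "(adjacent ?S)\<^sup>*\<^sup>* u c \<and> (adjacent ?S)\<^sup>*\<^sup>* c u" if "u \<in> verts ?S" for u
    using that by (auto simp: star_def add_vertex_def)
  then have "(adjacent ?S)\<^sup>*\<^sup>* u v" if "u \<in> verts ?S" "v \<in> verts ?S" for u v
    using that by (meson rtranclp_trans)
  moreover have "verts ?S \<noteq> {}" by (simp add: star_def add_vertex_def)
  ultimately have "connected_graph ?S" by (simp only: connected_graph_def) blast
  with \<open>subgraph ?S T\<close> show ?thesis by (simp add: subtree_def)
qed

section \<open>Structure of star-flip presentations\<close>

text \<open>A joint induction: that \<open>x\<close> is fresh for every live tree uses that live
  trees lie in \<open>H\<close>. Equality of the neighbour sets in \<open>\<S>\<close> makes the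
  renamed edges at \<open>x\<close> exactly edges added by the flip.\<close>

lemma star_flip_structure:
  assumes "star_flip_presentation r H \<T>"
  shows "simple_graph H" "\<And>T. T \<in> \<T> \<Longrightarrow> tree T" "\<And>T. T \<in> \<T> \<Longrightarrow> subgraph T H"
    "\<And>T Q. T \<in> \<T> \<Longrightarrow> subtree Q T \<Longrightarrow> Q \<in> \<T>"
proof -
  have "simple_graph H \<and> (\<forall>T\<in>\<T>. tree T \<and> subgraph T H \<and> (\<forall>Q. subtree Q T \<longrightarrow> Q \<in> \<T>))"
    using assms
  proof (induction rule: star_flip_presentation.induct)
    case (seed R)
    have "tree Q" "subgraph Q R" "P \<in> {Q. subtree Q R}" if "subtree Q R" "subtree P Q \<or> P = Q" for P Q
      using tree_subtree[OF seed that(1)] subtree_trans[of P Q R] that by (auto simp only: subtree_def)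
    then show ?case
      using seed by (metis mem_Collect_eq tree_def)
  next
    case (flip H \<T> T c x \<S>)
    let ?H = "add_vertex x (neighbourhood T c) H"
    have HT: "simple_graph H" "tree T" "subgraph T H" using flip by auto
    have sT: "simple_graph T" using HT by (simp add: tree_def)
    have "neighbourhood T c \<subseteq> verts H"
      using neighbourhood_subset[OF sT, of c] HT by (auto simp: subgraph_def)
    then have sH: "simple_graph ?H" using simple_add_vertex HT flip.hyps by metis
    have sub: "subgraph S ?H" if "subgraph S H" for S
      using that by (auto simp: subgraph_def add_vertex_def)
    have new: "tree (replace_vertex c x S)" "subgraph (replace_vertex c x S) ?H" if S: "S \<in> \<S>" for S
    proof -
      have S': "tree S" "subgraph S H" "c \<in> verts S" "neighbourhood S c = neighbourhood T c"
        using S flip by auto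
      have xS: "x \<notin> verts S" using S' flip.hyps by (auto simp: subgraph_def)
      show tr: "tree (replace_vertex c x S)" using tree_replace_vertex S' xS by metis
      have sS: "simple_graph S" using S' by (simp add: tree_def)
      have "id(c := x) ` e \<in> edges ?H" if e: "e \<in> edges S" for e
      proof (cases "c \<in> e")
        case True
        then obtain a where a: "e = {c, a}" "a \<in> neighbourhood S c"
          using edges_at[OF sS, of c] e by auto
        then have "a \<noteq> c" using neighbourhood_subset[OF sS, of c] by auto
        then have "id(c := x) ` e = {x, a}" using a by auto
        then show ?thesis using a S' by (auto simp: add_vertex_def)
      next
        case False
        then have "id(c := x) ` e = e" by (auto simp: image_def)
        then show ?thesis using e S' by (auto simp: add_vertex_def subgraph_def)
      qed
      then show "subgraph (replace_vertex c x S) ?H"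
        using tr S' by (auto simp: subgraph_def tree_def replace_vertex_def add_vertex_def)
    qed
    have ok: "tree Q \<and> subgraph Q ?H" if "S \<in> \<S>" "subtree Q (replace_vertex c x S)" for S Q
      using tree_subtree[OF new(1)[OF that(1)] that(2)] subgraph_trans[OF _ new(2)[OF that(1)]] that(2)
      by (simp only: subtree_def)
    show ?case
    proof (intro conjI ballI allI impI)
      show "simple_graph ?H" by (fact sH)
    next
      fix Q assume "Q \<in> \<T> \<union> (\<Union>T'\<in>\<S>. {Q. subtree Q (replace_vertex c x T')})"
      then consider "Q \<in> \<T>" | S where "S \<in> \<S>" "subtree Q (replace_vertex c x S)" by blast
      note Q = this
      show "tree Q" using Q flip.IH ok by metis
      show "subgraph Q ?H" using Q flip.IH ok sub by metis
      fix P assume P: "subtree P Q"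
      from Q show "P \<in> \<T> \<union> (\<Union>T'\<in>\<S>. {Q. subtree Q (replace_vertex c x T')})"
      proof cases
        case 1
        then show ?thesis using flip.IH P by blast
      next
        case 2
        then show ?thesis using subtree_trans[OF P] by blast
      qed
    qed
  qed
  then show "simple_graph H" "\<And>T. T \<in> \<T> \<Longrightarrow> tree T" "\<And>T. T \<in> \<T> \<Longrightarrow> subgraph T H"
    "\<And>T Q. T \<in> \<T> \<Longrightarrow> subtree Q T \<Longrightarrow> Q \<in> \<T>" by auto
qed


section \<open>Tree-indexed random walks\<close>

text \<open>Measurability with respect to the coordinates in \<open>U\<close>; such functions serve
  as test functions for marginals.\<close>

definition depends_on :: "'a set \<Rightarrow> (('a \<Rightarrow> 'b) \<Rightarrow> real) \<Rightarrow> bool" where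
  "depends_on U f \<longleftrightarrow> (\<forall>\<phi> \<psi>. (\<forall>u\<in>U. \<phi> u = \<psi> u) \<longrightarrow> f \<phi> = f \<psi>)"

lemma depends_onD: "depends_on U f \<Longrightarrow> (\<And>u. u \<in> U \<Longrightarrow> \<phi> u = \<psi> u) \<Longrightarrow> f \<phi> = f \<psi>"
  by (auto simp: depends_on_def)

lemma depends_on_mono: "depends_on U f \<Longrightarrow> U \<subseteq> V \<Longrightarrow> depends_on V f"
  unfolding depends_on_def by blast

locale host =
  fixes G :: "'b sgraph" and \<delta> :: real
  assumes simple: "simple_graph G" and \<delta>_pos: "0 < \<delta>"
    and min_degree: "v \<in> verts G \<Longrightarrow> \<delta> \<le> real (degree G v)"
begin

abbreviation deg :: "'b \<Rightarrow> real" where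
  "deg v \<equiv> real (degree G v)"

text \<open>Extensional functions are determined by their values on \<open>U\<close>, so a sum over
  \<open>maps U\<close> counts every assignment once.\<close>

definition maps :: "'a set \<Rightarrow> ('a \<Rightarrow> 'b) set" where
  "maps U = U \<rightarrow>\<^sub>E verts G"

text \<open>The argument is the image of an edge. A collapsed edge has a singleton image, which is
  no edge of \<open>G\<close>, and so it gets weight 0.\<close>

definition edge_weight :: "'b set \<Rightarrow> real" where
  "edge_weight e = (if e \<in> edges G then 1 / (\<Prod>v\<in>e. deg v) else 0)"

text \<open>Up to normalisation by \<open>total\<close> below, the law of the random walk indexed by the tree \<open>T\<close>:
  the root is chosen proportionally to its degree, and every child uniformly among the neighbours
  of its parent.  Grouping the factors by vertices and edges makes the root irrelevant.\<close>

definition weight :: "'a sgraph \<Rightarrow> ('a \<Rightarrow> 'b) \<Rightarrow> real" where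
  "weight T \<phi> = (\<Prod>v\<in>verts T. deg (\<phi> v)) * (\<Prod>e\<in>edges T. edge_weight (\<phi> ` e))"

definition total :: real where
  "total = (\<Sum>v\<in>verts G. deg v)"

text \<open>The factors of \<open>weight\<close> that involve the centre when it sits at
  \<open>y\<close>; \<open>rest_weight\<close> collects the others.\<close>

definition star_weight :: "'a set \<Rightarrow> 'b \<Rightarrow> ('a \<Rightarrow> 'b) \<Rightarrow> real" where
  "star_weight N y \<phi> = deg y * (\<Prod>a\<in>N. edge_weight {y, \<phi> a})"

definition rest_weight :: "'a sgraph \<Rightarrow> 'a \<Rightarrow> ('a \<Rightarrow> 'b) \<Rightarrow> real" where
  "rest_weight T c \<phi> = (\<Prod>v\<in>verts T - {c}. deg (\<phi> v)) * (\<Prod>e\<in>{e \<in> edges T. c \<notin> e}. edge_weight (\<phi> ` e))"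

text \<open>The law of the centre of a star given the images of its leaves; it vanishes where the
  leaves have no common neighbour.\<close>

definition star_kernel :: "'a set \<Rightarrow> 'b \<Rightarrow> ('a \<Rightarrow> 'b) \<Rightarrow> real" where
  "star_kernel N y \<phi> = star_weight N y \<phi> / (\<Sum>z\<in>verts G. star_weight N z \<phi>)"

section \<open>Elementary properties of weights and kernels\<close>

lemma finite_verts: "finite (verts G)"
  using simple by (simp add: simple_graph_def)

lemma deg_pos: "v \<in> verts G \<Longrightarrow> 0 < deg v"
  using min_degree[of v] \<delta>_pos by linarith

lemma mapsD: "\<phi> \<in> maps U \<Longrightarrow> u \<in> U \<Longrightarrow> \<phi> u \<in> verts G"
  by (auto simp: maps_def)

lemma maps_insertE:
  assumes "\<psi> \<in> maps (insert x U)" "x \<notin> U"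
  obtains \<phi> y where "\<phi> \<in> maps U" "y \<in> verts G" "\<psi> = \<phi>(x := y)"
  using assms unfolding maps_def PiE_insert_eq by auto

lemma sum_maps_insert:
  assumes "x \<notin> U"
  shows "(\<Sum>\<phi>\<in>maps (insert x U). f \<phi>) = (\<Sum>\<phi>\<in>maps U. \<Sum>y\<in>verts G. f (\<phi>(x := y)))"
proof -
  have "(\<Sum>\<phi>\<in>maps (insert x U). f \<phi>) = (\<Sum>(y, \<phi>)\<in>verts G \<times> maps U. f (\<phi>(x := y)))"
    unfolding maps_def PiE_insert_eq
    by (subst sum.reindex[OF inj_combinator[OF assms]]) (simp add: case_prod_unfold)
  also have "\<dots> = (\<Sum>y\<in>verts G. \<Sum>\<phi>\<in>maps U. f (\<phi>(x := y)))"
    by (simp add: sum.cartesian_product)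
  finally show ?thesis by (simp add: sum.swap[of _ "maps U"])
qed

lemma edge_weight_nonneg: "0 \<le> edge_weight e"
  by (simp add: edge_weight_def prod_nonneg)

lemma star_weight_nonneg: "0 \<le> star_weight N y \<phi>"
  by (simp add: star_weight_def prod_nonneg edge_weight_nonneg)

lemma star_kernel_nonneg: "0 \<le> star_kernel N y \<phi>"
  by (simp add: star_kernel_def sum_nonneg star_weight_nonneg)

lemma weight_nonneg: "0 \<le> weight T \<phi>"
  by (simp add: weight_def prod_nonneg edge_weight_nonneg)

lemma star_weight_cong: "(\<And>a. a \<in> N \<Longrightarrow> \<phi> a = \<psi> a) \<Longrightarrow> star_weight N y \<phi> = star_weight N y \<psi>"
  by (simp add: star_weight_def cong: prod.cong)

lemma star_kernel_cong: "(\<And>a. a \<in> N \<Longrightarrow> \<phi> a = \<psi> a) \<Longrightarrow> star_kernel N y \<phi> = star_kernel N y \<psi>"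
  unfolding star_kernel_def using star_weight_cong[of N \<phi> \<psi>] by simp

lemma weight_cong:
  assumes "simple_graph T" "\<And>v. v \<in> verts T \<Longrightarrow> \<phi> v = \<psi> v"
  shows "weight T \<phi> = weight T \<psi>"
proof -
  have "\<phi> ` e = \<psi> ` e" if "e \<in> edges T" for e
    using that assms by (intro image_cong) (auto simp: simple_graph_def)
  then show ?thesis using assms(2) by (simp add: weight_def cong: prod.cong)
qed

lemma edge_weight_doubleton:
  "edge_weight {y, a} = (if adjacent G y a then 1 / (deg y * deg a) else 0)"
  using adjacentD(3)[OF simple, of y a] by (auto simp: edge_weight_def adjacent_def)

text \<open>The summand is the transition probability of the simple random walk from
  \<open>a\<close> to \<open>y\<close>.\<close>

lemma sum_edge_weight:
  assumes "a \<in> verts G"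
  shows "(\<Sum>y\<in>verts G. deg y * edge_weight {y, a}) = 1"
proof -
  have "(\<Sum>y\<in>verts G. deg y * edge_weight {y, a}) = (\<Sum>y\<in>verts G. if y \<in> neighbourhood G a then 1 / deg a else 0)"
    by (intro sum.cong) (use deg_pos in \<open>auto simp: edge_weight_doubleton neighbourhood_def adjacent_sym[of G a]\<close>)
  also have "\<dots> = (\<Sum>y\<in>verts G \<inter> neighbourhood G a. 1 / deg a)"
    by (rule sum.inter_restrict[OF finite_verts, symmetric])
  also have "verts G \<inter> neighbourhood G a = neighbourhood G a"
    using neighbourhood_subset[OF simple, of a] by auto
  finally show ?thesis using deg_pos[OF assms] by (simp add: degree_def)
qed

lemma weight_split:
  assumes T: "simple_graph T" and c: "c \<in> verts T"
  shows "weight T \<phi> = rest_weight T c \<phi> * star_weight (neighbourhood T c) (\<phi> c) \<phi>"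
proof -
  have "(\<Prod>v\<in>verts T. deg (\<phi> v)) = deg (\<phi> c) * (\<Prod>v\<in>verts T - {c}. deg (\<phi> v))"
    using T c by (intro prod.remove) (auto simp: simple_graph_def)
  moreover have "(\<Prod>e\<in>edges T. edge_weight (\<phi> ` e))
      = (\<Prod>e\<in>{e \<in> edges T. c \<in> e}. edge_weight (\<phi> ` e)) * (\<Prod>e\<in>{e \<in> edges T. c \<notin> e}. edge_weight (\<phi> ` e))"
    by (subst prod.union_disjoint[symmetric])
      (use finite_edges[OF T] in \<open>auto intro!: prod.cong\<close>)
  moreover have "(\<Prod>e\<in>{e \<in> edges T. c \<in> e}. edge_weight (\<phi> ` e))
      = (\<Prod>a\<in>neighbourhood T c. edge_weight {\<phi> c, \<phi> a})"
    unfolding edges_at[OF T] by (subst prod.reindex[OF inj_on_doubleton]) simp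
  ultimately show ?thesis by (simp add: weight_def rest_weight_def star_weight_def)
qed

lemma rest_weight_cong:
  assumes T: "simple_graph T" and "\<And>v. v \<in> verts T - {c} \<Longrightarrow> \<phi> v = \<psi> v"
  shows "rest_weight T c \<phi> = rest_weight T c \<psi>"
proof -
  have "\<phi> ` e = \<psi> ` e" if "e \<in> edges T" "c \<notin> e" for e
    using that T by (intro image_cong refl assms(2)) (auto simp: simple_graph_def)
  then show ?thesis
    unfolding rest_weight_def using assms(2) by (intro arg_cong2[where f = "(*)"] prod.cong) auto
qed

text \<open>Neither factor on the right reads the value at \<open>c\<close>. This factorisation is
  the source of the Markov property.\<close>

lemma weight_upd:
  assumes T: "simple_graph T" and c: "c \<in> verts T"
  shows "weight T (\<phi>(c := y)) = rest_weight T c \<phi> * star_weight (neighbourhood T c) y \<phi>"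
proof -
  have "star_weight (neighbourhood T c) y (\<phi>(c := y)) = star_weight (neighbourhood T c) y \<phi>"
    using neighbourhood_subset[OF T, of c] by (intro star_weight_cong) auto
  moreover have "rest_weight T c (\<phi>(c := y)) = rest_weight T c \<phi>"
    by (intro rest_weight_cong T) auto
  ultimately show ?thesis using weight_split[OF T c, of "\<phi>(c := y)"] by simp
qed

text \<open>The leaf is the centre of a star with one edge, so attaching it contributes one step of
  the walk from the image of \<open>p\<close>.\<close>

lemma weight_leaf:
  assumes S: "simple_graph S" and l: "l \<notin> verts S" and p: "p \<in> verts S"
  shows "weight (add_vertex l {p} S) (\<phi>(l := y)) = weight S \<phi> * (deg y * edge_weight {y, \<phi> p})"
proof -
  let ?T = "add_vertex l {p} S"
  have T: "simple_graph ?T" using simple_add_vertex[OF S l] p by simp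
  have l': "l \<notin> e" if "e \<in> edges S" for e using that S l by (auto simp: simple_graph_def)
  have "neighbourhood ?T l = {p}"
    using l' p l by (auto simp: neighbourhood_def adjacent_def add_vertex_def doubleton_eq_iff)
  moreover have "{e \<in> edges ?T. l \<notin> e} = edges S" using l' by (auto simp: add_vertex_def)
  moreover have "verts ?T - {l} = verts S" "l \<in> verts ?T" using l by (auto simp: add_vertex_def)
  ultimately show ?thesis
    using weight_upd[OF T, of l \<phi> y] by (simp add: rest_weight_def weight_def star_weight_def)
qed

section \<open>Marginals and resampling\<close>

lemma marginal_leaf:
  assumes S: "simple_graph S" and l: "l \<notin> verts S" and p: "p \<in> verts S" and f: "depends_on (verts S) f"
  shows "(\<Sum>\<phi>\<in>maps (verts (add_vertex l {p} S)). weight (add_vertex l {p} S) \<phi> * f \<phi>)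
    = (\<Sum>\<phi>\<in>maps (verts S). weight S \<phi> * f \<phi>)"
proof -
  have "verts (add_vertex l {p} S) = insert l (verts S)" by (simp add: add_vertex_def)
  moreover have "(\<Sum>y\<in>verts G. weight S \<phi> * (deg y * edge_weight {y, \<phi> p}) * f (\<phi>(l := y)))
      = weight S \<phi> * f \<phi>" if "\<phi> \<in> maps (verts S)" for \<phi>
  proof -
    have "f (\<phi>(l := y)) = f \<phi>" for y using f by (rule depends_onD) (use l in auto)
    then have "(\<Sum>y\<in>verts G. weight S \<phi> * (deg y * edge_weight {y, \<phi> p}) * f (\<phi>(l := y)))
      = weight S \<phi> * f \<phi> * (\<Sum>y\<in>verts G. deg y * edge_weight {y, \<phi> p})"
      by (simp add: sum_distrib_left mult_ac)
    then show ?thesis using sum_edge_weight[OF mapsD[OF that p]] by simp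
  qed
  ultimately show ?thesis by (simp add: sum_maps_insert l weight_leaf[OF S l p])
qed

text \<open>Consistency of the walks: leaves are summed out one by one, each with total transition
  probability 1.\<close>

lemma marginal_subtree:
  assumes T: "tree T" and Q: "subtree Q T" and f: "depends_on (verts Q) f"
  shows "(\<Sum>\<phi>\<in>maps (verts T). weight T \<phi> * f \<phi>) = (\<Sum>\<phi>\<in>maps (verts Q). weight Q \<phi> * f \<phi>)"
proof -
  \<comment> \<open>The inclusion is carried along so that \<open>f\<close> counts as a function on
    every intermediate tree.\<close>
  have "verts Q \<subseteq> verts T \<and> (\<Sum>\<phi>\<in>maps (verts T). weight T \<phi> * f \<phi>) = (\<Sum>\<phi>\<in>maps (verts Q). weight Q \<phi> * f \<phi>)"
    using T Q
  proof (induction rule: subtree_induct)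
    case (leaf S l p)
    then have "simple_graph S" by (auto simp: subtree_def subgraph_def)
    then have "(\<Sum>\<phi>\<in>maps (verts (add_vertex l {p} S)). weight (add_vertex l {p} S) \<phi> * f \<phi>)
      = (\<Sum>\<phi>\<in>maps (verts S). weight S \<phi> * f \<phi>)"
      using leaf depends_on_mono[OF f] by (intro marginal_leaf) auto
    then show ?case using leaf by (auto simp: add_vertex_def)
  qed simp
  then show ?thesis ..
qed

lemma weight_replace:
  assumes T: "simple_graph T" and x: "x \<notin> verts T"
  shows "weight (replace_vertex c x T) \<phi> = weight T (\<phi> \<circ> id(c := x))"
proof -
  have "inj_on (\<lambda>e. id(c := x) ` e) (edges T)"
    using inj_on_image_eq_iff[OF inj_on_replace[OF x]] T
    by (intro inj_onI) (meson simple_graph_def)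
  then show ?thesis
    using inj_on_replace[OF x, of c]
    by (simp only: weight_def replace_vertex_def fst_conv snd_conv prod.reindex o_def image_image)
qed

text \<open>If the normaliser is 0, the kernel is 0 by division by zero, and every star weight
  vanishes too, being a nonnegative summand of it.\<close>

lemma star_weight_kernel:
  assumes "y \<in> verts G"
  shows "(\<Sum>z\<in>verts G. star_weight N z \<phi>) * star_kernel N y \<phi> = star_weight N y \<phi>"
proof (cases "(\<Sum>z\<in>verts G. star_weight N z \<phi>) = 0")
  case True
  then have "star_weight N y \<phi> = 0"
    using assms finite_verts by (subst (asm) sum_nonneg_eq_0_iff) (auto simp: star_weight_nonneg)
  then show ?thesis using True by simp
qed (simp add: star_kernel_def)

text \<open>Markov property: given its neighbours, the centre is independent of the rest of the tree,
  so resampling it does not change the law of the walk.\<close>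

lemma marginal_flip:
  assumes T: "simple_graph T" and x: "x \<notin> verts T" and c: "c \<in> verts T"
    and f: "depends_on (verts (replace_vertex c x T)) f"
  shows "(\<Sum>\<phi>\<in>maps (verts T). weight T \<phi> * (\<Sum>y\<in>verts G. star_kernel (neighbourhood T c) y \<phi> * f (\<phi>(x := y))))
    = (\<Sum>\<phi>\<in>maps (verts (replace_vertex c x T)). weight (replace_vertex c x T) \<phi> * f \<phi>)"
proof -
  let ?N = "neighbourhood T c" and ?V = "verts T - {c}" and ?T = "replace_vertex c x T"
  let ?g = "\<lambda>\<phi>. \<Sum>y\<in>verts G. star_kernel ?N y \<phi> * f (\<phi>(x := y))"
  have V: "verts T = insert c ?V" "verts ?T = insert x ?V"
    using c x by (auto simp: replace_vertex_def)
  \<comment> \<open>The old value of \<open>c\<close> is forgotten: \<open>c\<close> is neither one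
    of its own neighbours nor a vertex of the relabelled tree.\<close>
  have upd: "?g (\<phi>(c := z)) = ?g \<phi>" for \<phi> z
  proof (intro sum.cong refl arg_cong2[where f = "(*)"])
    fix y
    show "star_kernel ?N y (\<phi>(c := z)) = star_kernel ?N y \<phi>"
      using neighbourhood_subset[OF T, of c] by (intro star_kernel_cong) auto
    show "f ((\<phi>(c := z))(x := y)) = f (\<phi>(x := y))"
      using f by (rule depends_onD) (use V x c in auto)
  qed
  \<comment> \<open>In the relabelled tree \<open>x\<close> takes over the role of \<open>c\<close>,
    with the same leaves and the same remaining factors.\<close>
  have new: "weight ?T (\<phi>(x := y)) = rest_weight T c \<phi> * star_weight ?N y \<phi>" for \<phi> y
    unfolding weight_replace[OF T x] weight_upd[OF T c, symmetric]
    by (intro weight_cong T) (use x in auto)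
  have "(\<Sum>\<phi>\<in>maps (verts T). weight T \<phi> * ?g \<phi>)
      = (\<Sum>\<phi>\<in>maps ?V. \<Sum>z\<in>verts G. weight T (\<phi>(c := z)) * ?g (\<phi>(c := z)))"
    using sum_maps_insert[of c ?V "\<lambda>\<phi>. weight T \<phi> * ?g \<phi>"] V(1) by simp
  also have "\<dots> = (\<Sum>\<phi>\<in>maps ?V. rest_weight T c \<phi> * ((\<Sum>z\<in>verts G. star_weight ?N z \<phi>) * ?g \<phi>))"
  proof -
    have "(\<Sum>z\<in>verts G. a * s z * b) = a * ((\<Sum>z\<in>verts G. s z) * b)" for a b :: real and s
      by (simp add: sum_distrib_left sum_distrib_right mult.assoc)
    then show ?thesis by (simp only: upd weight_upd[OF T c])
  qed
  \<comment> \<open>Summing out the old centre produces precisely the denominator of the kernel, and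
    the two cancel.\<close>
  also have "\<dots> = (\<Sum>\<phi>\<in>maps ?V. \<Sum>y\<in>verts G. weight ?T (\<phi>(x := y)) * f (\<phi>(x := y)))"
  proof (intro sum.cong refl)
    fix \<phi> :: "'a \<Rightarrow> 'b"
    have "(\<Sum>z\<in>verts G. star_weight ?N z \<phi>) * ?g \<phi> = (\<Sum>y\<in>verts G. star_weight ?N y \<phi> * f (\<phi>(x := y)))"
      by (subst sum_distrib_left) (simp add: star_weight_kernel flip: mult.assoc)
    then show "rest_weight T c \<phi> * ((\<Sum>z\<in>verts G. star_weight ?N z \<phi>) * ?g \<phi>)
      = (\<Sum>y\<in>verts G. weight ?T (\<phi>(x := y)) * f (\<phi>(x := y)))"
      by (simp add: new sum_distrib_left mult.assoc)
  qed
  also have "\<dots> = (\<Sum>\<phi>\<in>maps (verts ?T). weight ?T \<phi> * f \<phi>)"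
    using x by (subst V(2), subst sum_maps_insert) auto
  finally show ?thesis .
qed

definition collision_mass :: "'a set \<Rightarrow> (('a \<Rightarrow> 'b) \<Rightarrow> real) \<Rightarrow> real" where
  "collision_mass V \<mu> = (\<Sum>\<phi>\<in>maps V. if inj_on \<phi> V then 0 else \<mu> \<phi>)"

text \<open>A union bound for one new coordinate drawn from \<open>q\<close>. Maps that already
  collide keep their mass; an injective map can only collide by sending \<open>x\<close> to some
  \<open>\<phi> v\<close>. Mass 1 of \<open>q\<close> is asked only where \<open>\<mu>\<close> is
  nonzero, since \<open>star_kernel\<close> can vanish elsewhere.\<close>

lemma collision_mass_insert:
  assumes U: "finite U" and x: "x \<notin> U"
    and \<mu>': "\<And>\<phi> y. \<phi> \<in> maps U \<Longrightarrow> \<mu>' (\<phi>(x := y)) = \<mu> \<phi> * q y \<phi>"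
    and \<mu>: "\<And>\<phi>. \<phi> \<in> maps U \<Longrightarrow> 0 \<le> \<mu> \<phi>" and q: "\<And>y \<phi>. 0 \<le> q y \<phi>"
    and q1: "\<And>\<phi>. \<phi> \<in> maps U \<Longrightarrow> \<mu> \<phi> \<noteq> 0 \<Longrightarrow> (\<Sum>y\<in>verts G. q y \<phi>) = 1"
    and b: "\<And>v. v \<in> U \<Longrightarrow> (\<Sum>\<phi>\<in>maps U. \<mu> \<phi> * q (\<phi> v) \<phi>) \<le> b"
  shows "collision_mass (insert x U) \<mu>' \<le> collision_mass U \<mu> + real (card U) * b"
proof -
  have "(\<Sum>y\<in>verts G. if inj_on (\<phi>(x := y)) (insert x U) then 0 else \<mu>' (\<phi>(x := y)))
      \<le> (if inj_on \<phi> U then 0 else \<mu> \<phi>) + (\<Sum>v\<in>U. \<mu> \<phi> * q (\<phi> v) \<phi>)" if \<phi>: "\<phi> \<in> maps U" for \<phi>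
  proof -
    have inj: "inj_on (\<phi>(x := y)) (insert x U) \<longleftrightarrow> inj_on \<phi> U \<and> y \<notin> \<phi> ` U" for y
    proof -
      have "inj_on (\<phi>(x := y)) U \<longleftrightarrow> inj_on \<phi> U" "(\<phi>(x := y)) ` U = \<phi> ` U"
        using x by (auto intro!: inj_on_cong)
      then show ?thesis using x by simp
    qed
    have sub: "\<phi> ` U \<subseteq> verts G" using \<phi> mapsD by auto
    show ?thesis
    proof (cases "inj_on \<phi> U")
      case True
      have "(\<Sum>y\<in>verts G. if inj_on (\<phi>(x := y)) (insert x U) then 0 else \<mu>' (\<phi>(x := y)))
        = (\<Sum>y\<in>verts G. if y \<in> \<phi> ` U then \<mu> \<phi> * q y \<phi> else 0)"
        unfolding inj using True \<mu>'[OF \<phi>] by (intro sum.cong) auto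
      also have "\<dots> = (\<Sum>y\<in>verts G \<inter> \<phi> ` U. \<mu> \<phi> * q y \<phi>)"
        by (simp add: sum.inter_restrict finite_verts)
      also have "verts G \<inter> \<phi> ` U = \<phi> ` U" using sub by auto
      finally show ?thesis using True by (simp only: sum.reindex) simp
    next
      case False
      have "(\<Sum>y\<in>verts G. if inj_on (\<phi>(x := y)) (insert x U) then 0 else \<mu>' (\<phi>(x := y)))
        = \<mu> \<phi> * (\<Sum>y\<in>verts G. q y \<phi>)"
        unfolding inj using False \<mu>'[OF \<phi>] by (simp add: sum_distrib_left)
      also have "\<dots> = \<mu> \<phi>" using q1[OF \<phi>] by (cases "\<mu> \<phi> = 0") auto
      also have "0 \<le> (\<Sum>v\<in>U. \<mu> \<phi> * q (\<phi> v) \<phi>)" using \<mu>[OF \<phi>] q by (intro sum_nonneg) simp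
      ultimately show ?thesis using False by simp
    qed
  qed
  then have "collision_mass (insert x U) \<mu>'
      \<le> (\<Sum>\<phi>\<in>maps U. (if inj_on \<phi> U then 0 else \<mu> \<phi>) + (\<Sum>v\<in>U. \<mu> \<phi> * q (\<phi> v) \<phi>))"
    unfolding collision_mass_def sum_maps_insert[OF x] by (rule sum_mono)
  also have "\<dots> = collision_mass U \<mu> + (\<Sum>v\<in>U. \<Sum>\<phi>\<in>maps U. \<mu> \<phi> * q (\<phi> v) \<phi>)"
    by (simp add: sum.distrib collision_mass_def sum.swap[of _ U])
  also have "\<dots> \<le> collision_mass U \<mu> + real (card U) * b"
    using sum_mono[of U _ "\<lambda>_. b", OF b] by simp
  finally show ?thesis .
qed

section \<open>Total mass and collisions along a tree\<close>

lemma total_ge: "real (card (verts G)) * \<delta> \<le> total"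
  unfolding total_def using sum_mono[of "verts G" "\<lambda>_. \<delta>" deg] min_degree by simp

lemma total_nonneg: "0 \<le> total"
  by (simp add: total_def sum_nonneg)

lemma weight_vertex: "weight ({v}, {}) \<phi> = deg (\<phi> v)"
  by (simp add: weight_def)

lemma maps_vertex: "(\<Sum>\<phi>\<in>maps {v}. f \<phi>) = (\<Sum>y\<in>verts G. f ((\<lambda>_. undefined)(v := y)))"
  using sum_maps_insert[of v "{}" f] by (simp add: maps_def fun_upd_def)

text \<open>Taking the marginal at a single vertex leaves the sum of the degrees.\<close>

lemma sum_weight:
  assumes T: "tree T"
  shows "(\<Sum>\<phi>\<in>maps (verts T). weight T \<phi>) = total"
proof -
  obtain v where v: "v \<in> verts T" using T by (auto simp: tree_def connected_graph_def)
  have "subtree ({v}, {}) T" using T v by (intro subtree_vertex) (auto simp: tree_def)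
  then have "(\<Sum>\<phi>\<in>maps (verts T). weight T \<phi> * 1) = (\<Sum>\<phi>\<in>maps {v}. weight ({v}, {}) \<phi> * 1)"
    using marginal_subtree[OF T, of "({v}, {})" "\<lambda>_. 1"] by (simp add: depends_on_def)
  then show ?thesis by (simp add: maps_vertex weight_vertex total_def)
qed

text \<open>A new leaf moves to a uniform neighbour, so it hits a given old vertex with probability
  at most \<open>1 / \<delta> \<le> \<epsilon>\<close>. The square of the order bounds the number of
  pairs of vertices.\<close>

lemma collision_mass_tree:
  assumes T: "tree T" and \<epsilon>: "1 \<le> \<epsilon> * \<delta>"
  shows "collision_mass (verts T) (weight T) \<le> real (card (verts T) ^ 2) * (\<epsilon> * total)"
proof -
  obtain v where v: "v \<in> verts T" using T by (auto simp: tree_def connected_graph_def)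
  have "subtree ({v}, {}) T" using T v by (intro subtree_vertex) (auto simp: tree_def)
  have \<epsilon>0: "0 \<le> \<epsilon>" using \<epsilon> \<delta>_pos by (smt (verit) mult_nonpos_nonneg)
  show ?thesis
    using T \<open>subtree ({v}, {}) T\<close>
  proof (induction rule: subtree_induct)
    case base
    have "collision_mass {v} (weight ({v}, {})) = 0" by (simp add: collision_mass_def)
    then show ?case using \<epsilon>0 total_nonneg by simp
  next
    case (leaf S l p)
    have S: "tree S" "simple_graph S" using tree_subtree[OF T leaf.hyps(1)] by (auto simp: tree_def)
    then have fin: "finite (verts S)" by (simp add: simple_graph_def)
    have "collision_mass (insert l (verts S)) (weight (add_vertex l {p} S))
      \<le> collision_mass (verts S) (weight S) + real (card (verts S)) * (\<epsilon> * total)"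
    proof (rule collision_mass_insert[where q = "\<lambda>y \<phi>. deg y * edge_weight {y, \<phi> p}"])
      fix v assume v: "v \<in> verts S"
      have "(\<Sum>\<phi>\<in>maps (verts S). weight S \<phi> * (deg (\<phi> v) * edge_weight {\<phi> v, \<phi> p}))
        \<le> (\<Sum>\<phi>\<in>maps (verts S). weight S \<phi> * \<epsilon>)"
      proof (intro sum_mono mult_left_mono weight_nonneg)
        fix \<phi> assume "\<phi> \<in> maps (verts S)"
        then have "\<phi> v \<in> verts G" "\<phi> p \<in> verts G" using v leaf.hyps by (auto intro: mapsD)
        then have "deg (\<phi> v) * edge_weight {\<phi> v, \<phi> p} \<le> 1 / deg (\<phi> p)"
          using deg_pos by (auto simp: edge_weight_doubleton)
        also have "\<dots> \<le> 1 / \<delta>"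
          using min_degree[OF \<open>\<phi> p \<in> verts G\<close>] \<delta>_pos by (intro divide_left_mono) auto
        also have "\<dots> \<le> \<epsilon>" using \<epsilon> \<delta>_pos by (simp add: field_simps)
        finally show "deg (\<phi> v) * edge_weight {\<phi> v, \<phi> p} \<le> \<epsilon>" .
      qed
      also have "\<dots> = \<epsilon> * total"
        by (simp add: sum_weight[OF S(1)] flip: sum_distrib_right)
      finally show "(\<Sum>\<phi>\<in>maps (verts S). weight S \<phi> * (deg (\<phi> v) * edge_weight {\<phi> v, \<phi> p})) \<le> \<epsilon> * total" .
    qed (use leaf.hyps fin in \<open>auto simp: weight_leaf[OF S(2)] intro!: weight_nonneg mult_nonneg_nonneg edge_weight_nonneg sum_edge_weight[OF mapsD[of _ "verts S" p]]\<close>)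
    also have "\<dots> \<le> real (card (verts S) ^ 2 + card (verts S)) * (\<epsilon> * total)"
      using leaf.IH by (simp add: algebra_simps)
    also have "\<dots> \<le> real (card (insert l (verts S)) ^ 2) * (\<epsilon> * total)"
      using leaf.hyps fin \<epsilon>0 total_nonneg
      by (intro mult_right_mono of_nat_mono) (auto simp: power2_eq_square)
    finally show ?case by (simp add: add_vertex_def)
  qed
qed

text \<open>Of the \<open>card N\<close> factors \<open>1 / deg y\<close>, one cancels against
  \<open>deg y\<close> and the others are at most \<open>1 / \<delta>\<close>; this is where
  \<open>N\<close> must be nonempty. The bound no longer depends on \<open>y\<close>.\<close>

lemma star_weight_le:
  assumes N: "finite N" "N \<noteq> {}" and y: "y \<in> verts G" and \<phi>: "\<And>a. a \<in> N \<Longrightarrow> \<phi> a \<in> verts G"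
  shows "star_weight N y \<phi> \<le> (1 / \<delta>) ^ (card N - 1) / (\<Prod>a\<in>N. deg (\<phi> a))"
proof -
  obtain m where m: "card N = Suc m" using N by (metis card_0_eq not0_implies_Suc)
  have "(\<Prod>a\<in>N. edge_weight {y, \<phi> a}) \<le> (\<Prod>a\<in>N. (1 / deg y) / deg (\<phi> a))"
    by (intro prod_mono conjI edge_weight_nonneg) (auto simp: edge_weight_doubleton)
  also have "\<dots> = (\<Prod>a\<in>N. 1 / deg y) / (\<Prod>a\<in>N. deg (\<phi> a))" by (rule prod_dividef)
  also have "(\<Prod>a\<in>N. 1 / deg y) = (1 / deg y) ^ Suc m" by (simp only: prod_constant m)
  finally have "star_weight N y \<phi> \<le> deg y * ((1 / deg y) ^ Suc m / (\<Prod>a\<in>N. deg (\<phi> a)))"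
    unfolding star_weight_def by (intro mult_left_mono) auto
  also have "\<dots> = (1 / deg y) ^ m / (\<Prod>a\<in>N. deg (\<phi> a))"
    using deg_pos[OF y] by simp
  also have "\<dots> \<le> (1 / \<delta>) ^ m / (\<Prod>a\<in>N. deg (\<phi> a))"
    using min_degree[OF y] \<delta>_pos by (intro divide_right_mono power_mono prod_nonneg divide_left_mono) auto
  finally show ?thesis by (simp add: m)
qed

lemma weight_star:
  assumes N: "finite N" "c \<notin> N"
  shows "weight (star c N) (\<phi>(c := y)) = (\<Prod>a\<in>N. deg (\<phi> a)) * star_weight N y \<phi>"
proof -
  let ?S = "star c N"
  have S: "simple_graph ?S"
    unfolding star_def using N by (intro simple_add_vertex) (auto simp: simple_graph_def)
  have "neighbourhood ?S c = N" "{e \<in> edges ?S. c \<notin> e} = {}" "verts ?S - {c} = N" "c \<in> verts ?S"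
    using N by (auto simp: star_def add_vertex_def neighbourhood_def adjacent_def doubleton_eq_iff)
  then show ?thesis using weight_upd[OF S, of c \<phi> y] by (simp add: rest_weight_def del: Collect_empty_eq)
qed

text \<open>The expected reciprocal of the normalising constant of the resampling kernel: the division
  cancels against the sum over the centre, so it remains to count the leaf tuples.\<close>

lemma star_collision:
  assumes N: "finite N" "c \<notin> N"
  shows "(\<Sum>\<phi>\<in>maps (insert c N). weight (star c N) \<phi> *
      (b / (\<Prod>a\<in>N. deg (\<phi> a)) / (\<Sum>z\<in>verts G. star_weight N z \<phi>)))
    \<le> real (card (verts G)) ^ card N * \<bar>b\<bar>" (is "(\<Sum>\<phi>\<in>_. _ * ?g \<phi>) \<le> _")
proof -
  have upd: "?g (\<phi>(c := y)) = ?g \<phi>" for \<phi> y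
  proof -
    have "star_weight N z (\<phi>(c := y)) = star_weight N z \<phi>" for z
      using N by (intro star_weight_cong) auto
    moreover have "(\<Prod>a\<in>N. deg ((\<phi>(c := y)) a)) = (\<Prod>a\<in>N. deg (\<phi> a))"
      using N by (intro prod.cong) auto
    ultimately show ?thesis by simp
  qed
  have "(\<Sum>\<phi>\<in>maps (insert c N). weight (star c N) \<phi> * ?g \<phi>)
    = (\<Sum>\<phi>\<in>maps N. \<Sum>y\<in>verts G. (\<Prod>a\<in>N. deg (\<phi> a)) * star_weight N y \<phi> * ?g \<phi>)"
    by (simp only: sum_maps_insert[OF N(2)] upd weight_star[OF N])
  also have "\<dots> \<le> (\<Sum>\<phi>\<in>maps N. \<bar>b\<bar>)"
  proof (rule sum_mono)
    fix \<phi> :: "'a \<Rightarrow> 'b"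
    let ?P = "\<Prod>a\<in>N. deg (\<phi> a)" and ?W = "\<Sum>y\<in>verts G. star_weight N y \<phi>"
    have "(\<Sum>y\<in>verts G. ?P * star_weight N y \<phi> * ?g \<phi>) = ?P * ?W * (b / ?P / ?W)"
      by (simp only: sum_distrib_left sum_distrib_right)
    \<comment> \<open>The left side is \<open>b\<close>, or 0 when a denominator vanishes; the
      absolute value covers both cases.\<close>
    also have "\<dots> \<le> \<bar>b\<bar>" by (cases "?P = 0"; cases "?W = 0") (auto simp del: prod_zero_iff)
    finally show "(\<Sum>y\<in>verts G. ?P * star_weight N y \<phi> * ?g \<phi>) \<le> \<bar>b\<bar>" .
  qed
  also have "\<dots> = real (card (verts G)) ^ card N * \<bar>b\<bar>"
    using N by (simp add: maps_def card_PiE)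
  finally show ?thesis .
qed

section \<open>Embedding star-flip graphs\<close>

text \<open>The invariant kept under flips. Marginals are expressed through test functions; the
  joint law of vertices that share no live tree is left open.\<close>

definition walk_measure :: "'a sgraph \<Rightarrow> 'a sgraph set \<Rightarrow> (('a \<Rightarrow> 'b) \<Rightarrow> real) \<Rightarrow> bool" where
  "walk_measure H \<T> \<mu> \<longleftrightarrow>
     (\<forall>\<phi>\<in>maps (verts H). 0 \<le> \<mu> \<phi>) \<and>
     (\<forall>\<phi>\<in>maps (verts H). \<mu> \<phi> \<noteq> 0 \<longrightarrow> (\<forall>e\<in>edges H. \<phi> ` e \<in> edges G)) \<and>
     (\<forall>T\<in>\<T>. \<forall>f. depends_on (verts T) f \<longrightarrow>
        (\<Sum>\<phi>\<in>maps (verts H). \<mu> \<phi> * f \<phi>) = (\<Sum>\<phi>\<in>maps (verts T). weight T \<phi> * f \<phi>)) \<and>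
     (\<Sum>\<phi>\<in>maps (verts H). \<mu> \<phi>) = total"

lemma walk_measure_seed:
  assumes R: "tree R"
  shows "walk_measure R {Q. subtree Q R} (weight R)"
proof -
  have "\<phi> ` e \<in> edges G" if "weight R \<phi> \<noteq> 0" "e \<in> edges R" for \<phi> e
  proof -
    have "edge_weight (\<phi> ` e) \<noteq> 0"
      using that R finite_edges[of R] by (auto simp: weight_def tree_def)
    then show ?thesis by (auto simp: edge_weight_def split: if_splits)
  qed
  then show ?thesis
    using sum_weight[OF R] marginal_subtree[OF R] by (simp add: walk_measure_def weight_nonneg)
qed

text \<open>Old live trees keep their laws because the kernel has mass 1 on the support of
  \<open>\<mu>\<close>; new ones obtain theirs from \<open>marginal_flip\<close>. The number
  \<open>b\<close> bounds the mass on which \<open>x\<close> meets one given old vertex.\<close>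

lemma walk_measure_flip:
  assumes pres: "star_flip_presentation r H \<T>" and T: "T \<in> \<T>" "c \<in> verts T" "1 \<le> degree T c"
    and x: "x \<notin> verts H"
    and \<S>: "\<S> = {T' \<in> \<T>. c \<in> verts T' \<and> neighbourhood T' c = neighbourhood T c}"
    and \<mu>: "walk_measure H \<T> \<mu>"
    and b: "real (card (verts G)) ^ degree T c * (1 / \<delta>) ^ (degree T c - 1) \<le> b"
  shows "\<exists>\<mu>'. walk_measure (add_vertex x (neighbourhood T c) H)
      (\<T> \<union> (\<Union>T'\<in>\<S>. {Q. subtree Q (replace_vertex c x T')})) \<mu>' \<and>
    collision_mass (insert x (verts H)) \<mu>' \<le> collision_mass (verts H) \<mu> + real (card (verts H)) * b"
proof -
  let ?U = "verts H" and ?N = "neighbourhood T c"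
  define \<mu>' where "\<mu>' \<psi> = \<mu> (restrict \<psi> ?U) * star_kernel ?N (\<psi> x) \<psi>" for \<psi>
  note str = star_flip_structure[OF pres]
  have sT: "simple_graph T" using str(2)[OF T(1)] by (simp add: tree_def)
  have finU: "finite ?U" using str(1) by (simp add: simple_graph_def)
  have NU: "?N \<subseteq> ?U - {c}" "c \<in> ?U"
    using neighbourhood_subset[OF sT, of c] str(3)[OF T(1)] T(2) by (auto simp: subgraph_def)
  have finN: "finite ?N" by (rule finite_neighbourhood[OF sT])
  have pos: "0 \<le> \<mu> \<phi>" and supp: "\<mu> \<phi> \<noteq> 0 \<Longrightarrow> e \<in> edges H \<Longrightarrow> \<phi> ` e \<in> edges G"
    if "\<phi> \<in> maps ?U" for \<phi> e using \<mu> that by (auto simp: walk_measure_def)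
  have marg: "(\<Sum>\<phi>\<in>maps ?U. \<mu> \<phi> * f \<phi>) = (\<Sum>\<phi>\<in>maps (verts S). weight S \<phi> * f \<phi>)"
    if "S \<in> \<T>" "depends_on (verts S) f" for S f using \<mu> that by (simp add: walk_measure_def)
  have kernel_upd: "star_kernel ?N y (\<phi>(x := z)) = star_kernel ?N y \<phi>" for \<phi> y z
    using NU x by (intro star_kernel_cong) auto
  have \<mu>'_upd: "\<mu>' (\<phi>(x := y)) = \<mu> \<phi> * star_kernel ?N y \<phi>" if "\<phi> \<in> maps ?U" for \<phi> y
  proof -
    have "restrict (\<phi>(x := y)) ?U = \<phi>"
      using that x by (intro ext) (auto simp: maps_def restrict_def PiE_def extensional_def)
    then show ?thesis by (simp add: \<mu>'_def kernel_upd)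
  qed
  \<comment> \<open>On the support the old centre value \<open>\<phi> c\<close> is a common
    neighbour of the leaf values, so the normaliser is positive.\<close>
  have kernel1: "(\<Sum>y\<in>verts G. star_kernel ?N y \<phi>) = 1" if \<phi>: "\<phi> \<in> maps ?U" "\<mu> \<phi> \<noteq> 0" for \<phi>
  proof -
    have c: "\<phi> c \<in> verts G" using mapsD[OF \<phi>(1)] NU by auto
    have "edge_weight {\<phi> c, \<phi> a} > 0" if a: "a \<in> ?N" for a
    proof -
      have "{c, a} \<in> edges H"
        using a str(3)[OF T(1)] by (auto simp: neighbourhood_def adjacent_def subgraph_def)
      then have "\<phi> ` {c, a} \<in> edges G" using supp[OF \<phi>] by blast
      then have "adjacent G (\<phi> c) (\<phi> a)" by (simp add: adjacent_def)
      then show ?thesis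
        using deg_pos adjacentD[OF simple] by (simp add: edge_weight_doubleton)
    qed
    then have "0 < star_weight ?N (\<phi> c) \<phi>"
      unfolding star_weight_def using deg_pos[OF c] by (intro mult_pos_pos prod_pos) auto
    then have "0 < (\<Sum>z\<in>verts G. star_weight ?N z \<phi>)"
      using c finite_verts star_weight_nonneg by (intro sum_pos2[of _ "\<phi> c"]) auto
    then show ?thesis by (simp add: star_kernel_def flip: sum_divide_distrib)
  qed
  have sum_\<mu>': "(\<Sum>\<psi>\<in>maps (insert x ?U). \<mu>' \<psi> * f \<psi>)
      = (\<Sum>\<phi>\<in>maps ?U. \<mu> \<phi> * (\<Sum>y\<in>verts G. star_kernel ?N y \<phi> * f (\<phi>(x := y))))" for f
    by (simp add: sum_maps_insert[OF x] \<mu>'_upd sum_distrib_left mult.assoc)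
  have sum_old: "(\<Sum>\<psi>\<in>maps (insert x ?U). \<mu>' \<psi> * f \<psi>) = (\<Sum>\<phi>\<in>maps ?U. \<mu> \<phi> * f \<phi>)"
    if f: "depends_on ?U f" for f
    unfolding sum_\<mu>'
  proof (intro sum.cong refl)
    fix \<phi> assume \<phi>: "\<phi> \<in> maps ?U"
    have "f (\<phi>(x := y)) = f \<phi>" for y using f by (rule depends_onD) (use x in auto)
    then have "(\<Sum>y\<in>verts G. star_kernel ?N y \<phi> * f (\<phi>(x := y))) = (\<Sum>y\<in>verts G. star_kernel ?N y \<phi>) * f \<phi>"
      by (simp add: sum_distrib_right)
    then show "\<mu> \<phi> * (\<Sum>y\<in>verts G. star_kernel ?N y \<phi> * f (\<phi>(x := y))) = \<mu> \<phi> * f \<phi>"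
      using kernel1[OF \<phi>] by (cases "\<mu> \<phi> = 0") auto
  qed
  have nonneg': "0 \<le> \<mu>' \<psi>" if "\<psi> \<in> maps (insert x ?U)" for \<psi>
    using that x by (elim maps_insertE) (auto simp: \<mu>'_upd pos star_kernel_nonneg)
  have supp': "\<psi> ` e \<in> edges G"
    if \<psi>: "\<psi> \<in> maps (insert x ?U)" "\<mu>' \<psi> \<noteq> 0" and e: "e \<in> edges (add_vertex x ?N H)" for \<psi> e
  proof -
    obtain \<phi> y where \<phi>: "\<phi> \<in> maps ?U" "\<psi> = \<phi>(x := y)" using maps_insertE[OF \<psi>(1) x] by metis
    then have nz: "\<mu> \<phi> \<noteq> 0" "star_kernel ?N y \<phi> \<noteq> 0" using \<psi>(2) \<mu>'_upd[OF \<phi>(1)] by auto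
    consider "e \<in> edges H" | a where "a \<in> ?N" "e = {x, a}"
      using e by (auto simp: add_vertex_def)
    then show ?thesis
    proof cases
      case 1
      then have "x \<notin> e" using str(1) x by (auto simp: simple_graph_def)
      then have "\<psi> ` e = \<phi> ` e" using \<phi>(2) by (auto simp: image_def)
      then show ?thesis using supp[OF \<phi>(1) nz(1) 1] by simp
    next
      case 2
      then have "a \<noteq> x" using NU x by auto
      have "edge_weight {y, \<phi> a} \<noteq> 0"
        using nz(2) 2(1) finN by (auto simp: star_kernel_def star_weight_def)
      then have "{y, \<phi> a} \<in> edges G" by (auto simp: edge_weight_def split: if_splits)
      then show ?thesis using 2 \<phi>(2) \<open>a \<noteq> x\<close> by (simp add: insert_commute)
    qed
  qed
  have marg_old: "(\<Sum>\<psi>\<in>maps (insert x ?U). \<mu>' \<psi> * f \<psi>) = (\<Sum>\<phi>\<in>maps (verts S). weight S \<phi> * f \<phi>)"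
    if S: "S \<in> \<T>" and f: "depends_on (verts S) f" for S f
  proof -
    have "depends_on ?U f" using depends_on_mono[OF f] str(3)[OF S] by (simp add: subgraph_def)
    then show ?thesis using sum_old marg[OF S f] by simp
  qed
  \<comment> \<open>The kernel depends on the flip only through the neighbour set of
    \<open>c\<close>, which \<open>S\<close> shares with \<open>T\<close>. So the flip is a
    resampling of \<open>c\<close> in \<open>S\<close> as well.\<close>
  have marg_new: "(\<Sum>\<psi>\<in>maps (insert x ?U). \<mu>' \<psi> * f \<psi>) = (\<Sum>\<phi>\<in>maps (verts Q). weight Q \<phi> * f \<phi>)"
    if S: "S \<in> \<S>" and Q: "subtree Q (replace_vertex c x S)" and f: "depends_on (verts Q) f" for S Q f
  proof -
    have S': "S \<in> \<T>" "c \<in> verts S" "neighbourhood S c = ?N" using S \<S> by auto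
    have sS: "tree S" "simple_graph S" using str(2)[OF S'(1)] by (auto simp: tree_def)
    have xS: "x \<notin> verts S" using str(3)[OF S'(1)] x by (auto simp: subgraph_def)
    have f': "depends_on (verts (replace_vertex c x S)) f"
      using depends_on_mono[OF f] Q by (simp add: subtree_def subgraph_def)
    let ?g = "\<lambda>\<phi>. \<Sum>y\<in>verts G. star_kernel ?N y \<phi> * f (\<phi>(x := y))"
    have "depends_on (verts S) ?g"
      unfolding depends_on_def
    proof (intro allI impI sum.cong refl arg_cong2[where f = "(*)"])
      fix \<phi> \<psi> :: "'a \<Rightarrow> 'b" and y assume eq: "\<forall>u\<in>verts S. \<phi> u = \<psi> u"
      show "star_kernel ?N y \<phi> = star_kernel ?N y \<psi>"
        using eq neighbourhood_subset[OF sS(2), of c] S'(3) by (intro star_kernel_cong) auto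
      show "f (\<phi>(x := y)) = f (\<psi>(x := y))"
        using f' by (rule depends_onD) (use eq in \<open>auto simp: replace_vertex_def split: if_splits\<close>)
    qed
    then have "(\<Sum>\<psi>\<in>maps (insert x ?U). \<mu>' \<psi> * f \<psi>) = (\<Sum>\<phi>\<in>maps (verts S). weight S \<phi> * ?g \<phi>)"
      using sum_\<mu>' marg[OF S'(1)] by simp
    also have "\<dots> = (\<Sum>\<phi>\<in>maps (verts (replace_vertex c x S)). weight (replace_vertex c x S) \<phi> * f \<phi>)"
      using marginal_flip[OF sS(2) xS S'(2) f'] S'(3) by simp
    also have "\<dots> = (\<Sum>\<phi>\<in>maps (verts Q). weight Q \<phi> * f \<phi>)"
      by (rule marginal_subtree[OF tree_replace_vertex[OF sS(1) xS S'(2)] Q f])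
    finally show ?thesis .
  qed
  have "(\<Sum>\<psi>\<in>maps (insert x ?U). \<mu>' \<psi>) = total"
    using sum_old[of "\<lambda>_. 1"] \<mu> by (simp add: depends_on_def walk_measure_def)
  moreover have "verts (add_vertex x ?N H) = insert x ?U" by (simp add: add_vertex_def)
  ultimately have walk': "walk_measure (add_vertex x ?N H)
      (\<T> \<union> (\<Union>T'\<in>\<S>. {Q. subtree Q (replace_vertex c x T')})) \<mu>'"
    unfolding walk_measure_def using nonneg' supp' marg_old marg_new by auto
  have "collision_mass (insert x ?U) \<mu>' \<le> collision_mass ?U \<mu> + real (card ?U) * b"
  proof (rule collision_mass_insert[where q = "star_kernel ?N"])
    fix v assume v: "v \<in> ?U"
    let ?b = "(1 / \<delta>) ^ (card ?N - 1)"
    let ?g = "\<lambda>\<phi>. ?b / (\<Prod>a\<in>?N. deg (\<phi> a)) / (\<Sum>z\<in>verts G. star_weight ?N z \<phi>)"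
    have ne: "?N \<noteq> {}" using T(3) by (auto simp: degree_def)
    \<comment> \<open>The joint law of \<open>\<phi> v\<close> and the star is unknown. Hence the
      kernel is replaced by a bound uniform in its target, which depends on the leaf values alone
      and can be evaluated on the live star.\<close>
    have "(\<Sum>\<phi>\<in>maps ?U. \<mu> \<phi> * star_kernel ?N (\<phi> v) \<phi>) \<le> (\<Sum>\<phi>\<in>maps ?U. \<mu> \<phi> * ?g \<phi>)"
      unfolding star_kernel_def
      using NU v by (intro sum_mono mult_left_mono divide_right_mono star_weight_le finN ne pos
          sum_nonneg star_weight_nonneg) (auto intro: mapsD)
    also have "\<dots> = (\<Sum>\<phi>\<in>maps (verts (star c ?N)). weight (star c ?N) \<phi> * ?g \<phi>)"
    proof (rule marg)
      show "star c ?N \<in> \<T>" using subtree_star[OF sT T(2)] str(4)[OF T(1)] by blast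
      have "star_weight ?N z \<phi> = star_weight ?N z \<psi>" "(\<Prod>a\<in>?N. deg (\<phi> a)) = (\<Prod>a\<in>?N. deg (\<psi> a))"
        if "\<forall>u\<in>verts (star c ?N). \<phi> u = \<psi> u" for \<phi> \<psi> z
        using that by (auto simp: star_def add_vertex_def intro!: star_weight_cong prod.cong)
      then show "depends_on (verts (star c ?N)) ?g"
        unfolding depends_on_def by (intro allI impI arg_cong2[where f = "(/)"] sum.cong refl) auto
    qed
    also have "\<dots> = (\<Sum>\<phi>\<in>maps (insert c ?N). weight (star c ?N) \<phi> * ?g \<phi>)"
      by (simp add: star_def add_vertex_def)
    also have "\<dots> \<le> real (card (verts G)) ^ card ?N * \<bar>?b\<bar>"
      using finN NU by (intro star_collision) auto
    also have "\<dots> \<le> b" using b \<delta>_pos by (simp add: degree_def)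
    finally show "(\<Sum>\<phi>\<in>maps ?U. \<mu> \<phi> * star_kernel ?N (\<phi> v) \<phi>) \<le> b" .
  qed (use finU x \<mu>'_upd pos star_kernel_nonneg kernel1 in auto)
  then show ?thesis using walk' by blast
qed

text \<open>The case \<open>k = 1\<close> of \<open>dense\<close> controls the seed tree, and the
  size of each flip controls the vertex it adds. A new vertex costs at most the current order times
  \<open>\<epsilon> * total\<close>, which the growth of the square absorbs.\<close>

lemma ex_walk_measure:
  assumes pres: "star_flip_presentation r H \<T>" and "1 \<le> r"
    and dense: "\<And>k. 1 \<le> k \<Longrightarrow> k \<le> r \<Longrightarrow> real (card (verts G)) ^ (k - 1) \<le> \<epsilon> * \<delta> ^ k"
  shows "\<exists>\<mu>. walk_measure H \<T> \<mu> \<and> collision_mass (verts H) \<mu> \<le> real (card (verts H) ^ 2) * (\<epsilon> * total)"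
  using pres
proof (induction rule: star_flip_presentation.induct)
  case (seed R)
  then show ?case
    using walk_measure_seed[OF seed] collision_mass_tree[OF seed, of \<epsilon>] dense[of 1] \<open>1 \<le> r\<close>
    by (intro exI[of _ "weight R"]) simp
next
  case (flip H \<T> T c x \<S>)
  obtain \<mu> where \<mu>: "walk_measure H \<T> \<mu>"
    "collision_mass (verts H) \<mu> \<le> real (card (verts H) ^ 2) * (\<epsilon> * total)" using flip.IH by blast
  let ?k = "degree T c" and ?n = "real (card (verts G))"
  obtain m where m: "?k = Suc m" using flip.hyps(4) by (cases ?k) auto
  have "1 \<le> \<epsilon> * \<delta>" using dense[of 1] \<open>1 \<le> r\<close> by simp
  then have \<epsilon>0: "0 \<le> \<epsilon>" using \<delta>_pos by (smt (verit) mult_nonpos_nonneg)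
  \<comment> \<open>With \<open>m = k - 1\<close>, this scales \<open>dense\<close> so that its
    right side becomes \<open>\<epsilon> * (?n * \<delta>)\<close>, which is at most
    \<open>\<epsilon> * total\<close> by the minimum degree.\<close>
  have "?n ^ m * (?n * (1 / \<delta>) ^ m) \<le> \<epsilon> * \<delta> ^ Suc m * (?n * (1 / \<delta>) ^ m)"
    using dense[of ?k] flip.hyps \<delta>_pos m by (intro mult_right_mono) auto
  also have "\<dots> = \<epsilon> * (?n * \<delta>)" using \<delta>_pos by (simp add: field_simps)
  also have "\<dots> \<le> \<epsilon> * total" using total_ge \<epsilon>0 by (intro mult_left_mono)
  finally have "?n ^ ?k * (1 / \<delta>) ^ (?k - 1) \<le> \<epsilon> * total" by (simp add: m mult_ac)
  from walk_measure_flip[OF flip.hyps(1-4,6,7) \<mu>(1) this]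
  obtain \<mu>' where \<mu>': "walk_measure (add_vertex x (neighbourhood T c) H)
      (\<T> \<union> (\<Union>T'\<in>\<S>. {Q. subtree Q (replace_vertex c x T')})) \<mu>'"
    "collision_mass (insert x (verts H)) \<mu>' \<le> collision_mass (verts H) \<mu> + real (card (verts H)) * (\<epsilon> * total)"
    by blast
  have fin: "finite (verts H)"
    using star_flip_structure(1)[OF flip.hyps(1)] by (simp add: simple_graph_def)
  note \<mu>'(2)
  also have "collision_mass (verts H) \<mu> + real (card (verts H)) * (\<epsilon> * total)
      \<le> real (card (verts H) ^ 2 + card (verts H)) * (\<epsilon> * total)"
    using \<mu>(2) by (simp add: algebra_simps)
  also have "\<dots> \<le> real (card (insert x (verts H)) ^ 2) * (\<epsilon> * total)"
    using flip.hyps(6) fin \<epsilon>0 total_nonneg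
    by (intro mult_right_mono of_nat_mono) (auto simp: power2_eq_square)
  finally show ?case using \<mu>'(1) by (auto simp: add_vertex_def)
qed

end

text \<open>The copy consists of the images of the edges of \<open>H\<close> only, so further edges
  of \<open>G\<close> between its vertices do no harm.\<close>

lemma contains_copyI:
  assumes H: "simple_graph H" and G: "simple_graph G"
    and inj: "inj_on \<phi> (verts H)" and verts: "\<phi> ` verts H \<subseteq> verts G"
    and hom: "\<And>e. e \<in> edges H \<Longrightarrow> \<phi> ` e \<in> edges G"
  shows "contains_copy G H"
proof -
  let ?S = "(\<phi> ` verts H, (\<lambda>e. \<phi> ` e) ` edges H)"
  have sub: "e \<subseteq> verts H" if "e \<in> edges H" for e using H that by (auto simp: simple_graph_def)
  have "subgraph ?S G"
    using H G verts hom sub by (auto simp: subgraph_def simple_graph_def) blast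
  moreover have "isomorphic H ?S"
    unfolding isomorphic_def
  proof (intro exI[of _ \<phi>] conjI ballI)
    show "bij_betw \<phi> (verts H) (verts ?S)" using inj by (simp add: bij_betw_def)
    fix u v assume uv: "u \<in> verts H" "v \<in> verts H"
    have "\<phi> ` {u, v} \<in> image \<phi> ` edges H \<longleftrightarrow> {u, v} \<in> edges H"
      by (rule inj_on_image_mem_iff[OF inj_on_image_Pow[OF inj]]) (use uv sub in auto)
    then show "adjacent H u v \<longleftrightarrow> adjacent ?S (\<phi> u) (\<phi> v)" by (simp add: adjacent_def)
  qed
  ultimately show ?thesis unfolding contains_copy_def by blast
qed

text \<open>Non-injective maps carry less than the total mass, so some injective map has nonzero
  mass, and the support of the measure consists of homomorphisms.\<close>

lemma (in host) star_flip_contains_copy: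
  assumes pres: "star_flip_presentation r H \<T>" and "1 \<le> r"
    and dense: "\<And>k. 1 \<le> k \<Longrightarrow> k \<le> r \<Longrightarrow> real (card (verts G)) ^ (k - 1) \<le> \<epsilon> * \<delta> ^ k"
    and small: "real (card (verts H) ^ 2) * \<epsilon> < 1" and ne: "verts G \<noteq> {}"
  shows "contains_copy G H"
proof -
  obtain \<mu> where \<mu>: "walk_measure H \<T> \<mu>"
    "collision_mass (verts H) \<mu> \<le> real (card (verts H) ^ 2) * (\<epsilon> * total)"
    using ex_walk_measure[OF pres \<open>1 \<le> r\<close> dense] by blast
  have "0 < total" using total_ge ne finite_verts \<delta>_pos by (smt (verit) card_gt_0_iff mult_pos_pos of_nat_0_less_iff)
  then have "collision_mass (verts H) \<mu> < total"
    using \<mu>(2) mult_strict_right_mono[OF small \<open>0 < total\<close>] by (simp only: mult.assoc mult_1)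
  moreover have "(\<Sum>\<phi>\<in>maps (verts H). \<mu> \<phi>) = total" using \<mu>(1) by (simp add: walk_measure_def)
  ultimately have "\<not> (\<forall>\<phi>\<in>maps (verts H). (if inj_on \<phi> (verts H) then 0 else \<mu> \<phi>) = \<mu> \<phi>)"
    unfolding collision_mass_def using sum.cong[of "maps (verts H)" "maps (verts H)"] by fastforce
  then obtain \<phi> where \<phi>: "\<phi> \<in> maps (verts H)" "inj_on \<phi> (verts H)" "\<mu> \<phi> \<noteq> 0"
    by (auto split: if_splits)
  show ?thesis
  proof (rule contains_copyI[OF star_flip_structure(1)[OF pres] simple \<phi>(2)])
    show "\<phi> ` verts H \<subseteq> verts G" using \<phi>(1) mapsD by auto
    show "\<phi> ` e \<in> edges G" if "e \<in> edges H" for e using \<mu>(1) \<phi> that by (auto simp: walk_measure_def)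
  qed
qed

section \<open>Turan numbers of star-flip graphs\<close>

text \<open>Deleting a vertex of degree below \<open>\<delta>\<close> loses fewer than
  \<open>\<delta>\<close> edges and lowers the left side of the edge bound by
  \<open>\<delta>\<close>, so the bound persists. It fails for the empty graph, hence the process
  stops earlier.\<close>

lemma min_degree_subgraph:
  fixes G :: "'b sgraph" and \<delta> :: real
  assumes "simple_graph G" "0 \<le> \<delta>" "\<delta> * real (card (verts G)) < real (card (edges G))"
  shows "\<exists>G'. subgraph G' G \<and> verts G' \<noteq> {} \<and> (\<forall>v\<in>verts G'. \<delta> \<le> real (degree G' v))"
  using assms(1,3)
proof (induction "card (verts G)" arbitrary: G rule: less_induct)
  case less
  have fin: "finite (verts G)" using less.prems by (simp add: simple_graph_def)
  show ?case
  proof (cases "\<forall>v\<in>verts G. \<delta> \<le> real (degree G v)")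
    case True
    have "verts G \<noteq> {}"
    proof
      assume "verts G = {}"
      then have "edges G = {}" using less.prems(1) by (auto simp: simple_graph_def)
      then show False using less.prems(2) \<open>verts G = {}\<close> by simp
    qed
    then show ?thesis using True less.prems by (intro exI[of _ G]) (simp add: subgraph_def)
  next
    case False
    then obtain v where v: "v \<in> verts G" "real (degree G v) < \<delta>" by auto
    let ?G = "(verts G - {v}, {e \<in> edges G. v \<notin> e})"
    have sub: "subgraph ?G G" using less.prems(1) by (auto simp: subgraph_def simple_graph_def)
    have "{e \<in> edges G. v \<in> e} \<union> edges ?G = edges G" by auto
    then have "card (edges G) \<le> card {e \<in> edges G. v \<in> e} + card (edges ?G)"
      using card_Un_le[of "{e \<in> edges G. v \<in> e}" "edges ?G"] by (simp only:)
    also have "card {e \<in> edges G. v \<in> e} = degree G v"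
      by (simp add: edges_at[OF less.prems(1)] card_image[OF inj_on_doubleton] degree_def)
    finally have "real (card (edges G)) < \<delta> + real (card (edges ?G))" using v(2) by linarith
    moreover have card: "card (verts G) = Suc (card (verts ?G))"
      using card.remove[OF fin v(1)] by (simp only: fst_conv)
    ultimately have "\<delta> * real (card (verts ?G)) < real (card (edges ?G))"
      using less.prems(2) by (simp add: algebra_simps)
    moreover have "simple_graph ?G" using sub by (simp add: subgraph_def)
    ultimately have "\<exists>G'. subgraph G' ?G \<and> verts G' \<noteq> {} \<and> (\<forall>v\<in>verts G'. \<delta> \<le> real (degree G' v))"
      using card by (intro less.hyps) simp_all
    then show ?thesis using subgraph_trans[OF _ sub] by blast
  qed
qed

lemma contains_copy_subgraph: "subgraph G' G \<Longrightarrow> contains_copy G' H \<Longrightarrow> contains_copy G H"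
  by (auto simp: contains_copy_def intro: subgraph_trans)

text \<open>The exponents satisfy \<open>k - 1 \<le> (1 - 1 / r) * k\<close> exactly because
  \<open>k \<le> r\<close>; this is where the exponent of the theorem comes from. Of the factor
  \<open>C ^ k\<close>, one \<open>C\<close> cancels \<open>1 / C\<close> and the rest is at least
  1.\<close>

lemma power_le_powr_degree:
  assumes n: "1 \<le> n" and C: "1 \<le> C" and k: "1 \<le> k" "k \<le> r"
  shows "real n ^ (k - 1) \<le> 1 / C * (C * real n powr (1 - 1 / real r)) ^ k"
proof -
  have "real k \<le> real r" "0 < real r" using k by auto
  then have "real (k - 1) \<le> (1 - 1 / real r) * real k" using k by (simp add: field_simps of_nat_diff)
  have "real n ^ (k - 1) = real n powr real (k - 1)" using n by (simp add: powr_realpow)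
  also have "\<dots> \<le> real n powr ((1 - 1 / real r) * real k)"
    using \<open>real (k - 1) \<le> _\<close> n by (intro powr_mono) auto
  also have "\<dots> = (real n powr (1 - 1 / real r)) ^ k" using n by (simp add: powr_power mult.commute)
  also have "\<dots> \<le> C ^ (k - 1) * (real n powr (1 - 1 / real r)) ^ k"
    using mult_right_mono[OF one_le_power[OF C, of "k - 1"], of "(real n powr (1 - 1 / real r)) ^ k"] by simp
  also have "\<dots> = 1 / C * (C * real n powr (1 - 1 / real r)) ^ k"
    using k C by (cases k) (auto simp: power_mult_distrib)
  finally show ?thesis .
qed

theorem theorem1p4:
  fixes r :: nat and H :: "'a sgraph"
  assumes "r \<ge> 2"
    and "star_flip_graph r H"
  shows "\<exists>C::real. C > 0 \<and>
           (\<forall>n::nat. n \<ge> 1 \<longrightarrow> real (turan_number n H) \<le> C * real n powr (2 - 1 / real r))"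
proof -
  obtain \<T> where pres: "star_flip_presentation r H \<T>"
    using assms(2) by (auto simp: star_flip_graph_def)
  \<comment> \<open>The role of \<open>\<epsilon>\<close> is played by \<open>1 / C\<close>, so
    \<open>C\<close> has to exceed the squared order of \<open>H\<close>; adding 1 also gives
    \<open>1 \<le> C\<close>.\<close>
  define C where "C = real (card (verts H) ^ 2) + 1"
  have C: "1 \<le> C" by (simp add: C_def)
  have bound: "real (card (edges G)) \<le> C * real n powr (2 - 1 / real r)"
    if n: "1 \<le> n" and G: "simple_graph G" "card (verts G) = n" "\<not> contains_copy G H" for n and G :: "nat sgraph"
  proof (rule ccontr)
    \<comment> \<open>Chosen so that \<open>\<delta> * n\<close> equals the claimed edge bound;
      exceeding it yields a subgraph of minimum degree at least \<open>\<delta>\<close>.\<close>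
    define \<delta> where "\<delta> = C * real n powr (1 - 1 / real r)"
    have \<delta>: "0 < \<delta>" using C n by (simp add: \<delta>_def)
    assume "\<not> ?thesis"
    moreover have "real n powr (2 - 1 / real r) = real n powr (1 - 1 / real r) * real n"
      using n powr_add[of "real n" "1 - 1 / real r" 1] by simp
    ultimately have "\<delta> * real (card (verts G)) < real (card (edges G))" using G(2) by (simp add: \<delta>_def)
    then obtain G' where G': "subgraph G' G" "verts G' \<noteq> {}" "\<forall>v\<in>verts G'. \<delta> \<le> real (degree G' v)"
      using min_degree_subgraph[OF G(1)] \<delta> by (metis less_imp_le)
    interpret host G' \<delta> by standard (use G' \<delta> in \<open>auto simp: subgraph_def\<close>)
    have "card (verts G') \<le> n"
      using G' G by (auto simp: subgraph_def simple_graph_def intro: card_mono)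
    \<comment> \<open>The subgraph may have fewer than \<open>n\<close> vertices while
      \<open>\<delta>\<close> stays tied to \<open>n\<close>; this only decreases the left
      side.\<close>
    then have dense: "real (card (verts G')) ^ (k - 1) \<le> 1 / C * \<delta> ^ k" if "1 \<le> k" "k \<le> r" for k
      using power_le_powr_degree[OF n C that] power_mono[of "real (card (verts G'))" "real n" "k - 1"]
      by (simp add: \<delta>_def)
    have small: "real (card (verts H) ^ 2) * (1 / C) < 1"
      using C by (simp add: divide_less_eq) (simp add: C_def)
    have "contains_copy G' H"
      by (rule star_flip_contains_copy[OF pres _ dense small G'(2)]) (use assms(1) in simp)
    from contains_copy_subgraph[OF G'(1) this] show False using G(3) by simp
  qed
  have "real (turan_number n H) \<le> C * real n powr (2 - 1 / real r)" if n: "1 \<le> n" for n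
  proof -
    \<comment> \<open>The maximum of a finite nonempty set is attained, here by 0 or by a graph
      without a copy of \<open>H\<close>.\<close>
    have "turan_number n H \<in> insert 0 {card (edges G) |G :: nat sgraph.
            simple_graph G \<and> card (verts G) = n \<and> \<not> contains_copy G H}"
      unfolding turan_number_def by (intro Max_in finite.insertI finite_turan_candidates insert_not_empty)
    then show ?thesis using bound[OF n] C by auto
  qed
  then show ?thesis using C by (intro exI[of _ C]) auto
qed

end
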